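(* Let $Q$ be a finite quiver and let $V$ be an indecomposable representation of $Q$ over $\mathbb{F}_1$. Then the following are equivalent: (i) $V$ is absolutely indecomposable; (ii) $V^{\mathbb{C}}$ is indecomposable; (iii) $\Gamma_{V\otimes V}$ contains exactly one covering component.
   Context: A quiver $Q=(Q_0,Q_1,s,t)$ has vertex set $Q_0$, arrow set $Q_1$ (both finite), and source/target maps $s,t\colon Q_1\to Q_0$. An $\mathbb{F}_1$-vector space is a finite pointed set $(V,0_V)$. An $\mathbb{F}_1$-linear map $f\colon V\to W$ is a pointed map that is injective on $V\setminus f^{-1}(0_W)$. The direct sum is $V\oplus W=V\sqcup_{0_V\sim 0_W}W$. A representation $V$ of $Q$ over $\mathbb{F}_1$ consists of an $\mathbb{F}_1$-vector space $V_i$ for each $i\in Q_0$ and an $\mathbb{F}_1$-linear map $V_\alpha\colon V_{s(\alpha)}\to V_{t(\alpha)}$ for each $\alpha\in Q_1$. Direct sums are formed vertexwise. $V$ is indecomposable if it is nonzero and not isomorphic to a direct sum of two nonzero representations (equivalently, its coefficient quiver, defined below, is connected). Scalar extension: for a field $K$, $V^K$ is the representation of $Q$ over $K$ where $V^K_i$ is the free $K$-vector space on $V_i\setminus\{0_{V_i}\}$ and the arrows act by the $K$-linear extensions of the maps $V_\alpha$ (with $0_{V_i}$ identified with $0$). An indecomposable $\mathbb{F}_1$-representation $V$ is absolutely indecomposable if $V^K$ is indecomposable for all fields $K$. Coefficient quiver: $\Gamma_V$ has vertex set $\coprod_{i\in Q_0}V_i\setminus\{0_{V_i}\}$ and arrow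 set $\coprod_{\alpha\in Q_1}\{(v,w)\in((\Gamma_V)_0)^2\mid V_\alpha(v)=w\}$, with $s((v,w))=v$, $t((v,w))=w$. The quiver morphism $c_V\colon\Gamma_V\to Q$ is induced by these disjoint unions. Tensor product: $(V\otimes W)_i=V_i\times W_i/(V_i\times\{0_{W_i}\}\cup\{0_{V_i}\}\times W_i)$ with $(V\otimes W)_\alpha(v\otimes w)=V_\alpha(v)\otimes W_\alpha(w)$. Its coefficient quiver $\Gamma_{V\otimes W}$ is identified with the quiver whose vertices are pairs $(v,w)\in(\Gamma_V)_0\times(\Gamma_W)_0$ with $c_V(v)=c_W(w)$ and whose arrows are pairs $(a,b)\in(\Gamma_V)_1\times(\Gamma_W)_1$ with $c_V(a)=c_W(b)$, where $s((a,b))=(s(a),s(b))$, $t((a,b))=(t(a),t(b))$. A morphism of quivers $\pi\colon R\to R'$ is a covering map if for every vertex $v\in R'_0$, every vertex $v'\in\pi^{-1}(v)$ and every arrow $a\in R'_1$ with $s(a)=v$ (respectively $t(a)=v$) there is a unique arrow $a'\in\pi^{-1}(a)$ with $s(a')=v'$ (respectively $t(a')=v'$). A connected component $C$ (connectedness in the underlying undirected graph) of $\Gamma_{V\otimes W}$ is a covering component if the two projections $\pi_1\colon C\to\Gamma_V$, $(v,w)\mapsto v$, $(a,b)\mapsto a$, and $\pi_2\colon C\to\Gamma_W$, $(v,w)\mapsto w$, $(a,b)\mapsto b$, are covering maps. *)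

theory Defs
  imports
    Complex_Main
    "Graph_Theory.Digraph_Component"
    "Jordan_Normal_Form.VS_Connect"
begin

text \<open>
  A quiver is a record \<open>('v, 'e) pre_digraph\<close> of the entry Graph Theory, which allows loops and
  parallel arcs; source and target are \<open>tail\<close> and \<open>head\<close>.  The predicate \<open>fin_digraph\<close> says that
  both vertex set and arrow set are finite and that every arrow starts and ends at a vertex.
\<close>

section \<open>Representations over \<open>\<F>\<^sub>1\<close>\<close>

record 'x f1_space =
  points :: "'x set"
  base :: 'x

definition f1_space :: "'x f1_space \<Rightarrow> bool" where
  "f1_space X \<longleftrightarrow> finite (points X) \<and> base X \<in> points X"

definition nonzero_points :: "'x f1_space \<Rightarrow> 'x set" where
  "nonzero_points X = points X - {base X}"

definition f1_linear :: "'x f1_space \<Rightarrow> 'y f1_space \<Rightarrow> ('x \<Rightarrow> 'y) \<Rightarrow> bool" where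
  "f1_linear X Y f \<longleftrightarrow> f \<in> points X \<rightarrow> points Y \<and> f (base X) = base Y
     \<and> inj_on f (points X - f -` {base Y})"

record ('v, 'e, 'x) f1_rep =
  f1_obj :: "'v \<Rightarrow> 'x f1_space"
  f1_map :: "'e \<Rightarrow> 'x \<Rightarrow> 'x"

definition f1_rep :: "('v, 'e) pre_digraph \<Rightarrow> ('v, 'e, 'x) f1_rep \<Rightarrow> bool" where
  "f1_rep Q V \<longleftrightarrow> (\<forall>i \<in> verts Q. f1_space (f1_obj V i))
     \<and> (\<forall>a \<in> arcs Q. f1_linear (f1_obj V (tail Q a)) (f1_obj V (head Q a)) (f1_map V a))"

definition f1_nonzero :: "('v, 'e) pre_digraph \<Rightarrow> ('v, 'e, 'x) f1_rep \<Rightarrow> bool" where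
  "f1_nonzero Q V \<longleftrightarrow> (\<exists>i \<in> verts Q. nonzero_points (f1_obj V i) \<noteq> {})"

definition f1_iso ::
  "('v, 'e) pre_digraph \<Rightarrow> ('v, 'e, 'x) f1_rep \<Rightarrow> ('v, 'e, 'y) f1_rep \<Rightarrow> bool" where
  "f1_iso Q V W \<longleftrightarrow> (\<exists>\<phi>.
     (\<forall>i \<in> verts Q. f1_linear (f1_obj V i) (f1_obj W i) (\<phi> i)
        \<and> bij_betw (\<phi> i) (points (f1_obj V i)) (points (f1_obj W i)))
     \<and> (\<forall>a \<in> arcs Q. \<forall>x \<in> points (f1_obj V (tail Q a)).
          \<phi> (head Q a) (f1_map V a x) = f1_map W a (\<phi> (tail Q a) x)))"

text \<open>
  In the direct sum, the two base points are glued: the common base point is represented by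
  \<open>Inl (base X)\<close>, and \<open>glue_right X Y\<close> is the inclusion of the second summand.
\<close>

definition glue_right :: "'x f1_space \<Rightarrow> 'y f1_space \<Rightarrow> 'y \<Rightarrow> 'x + 'y" where
  "glue_right X Y y = (if y = base Y then Inl (base X) else Inr y)"

definition f1_space_sum :: "'x f1_space \<Rightarrow> 'y f1_space \<Rightarrow> ('x + 'y) f1_space" where
  "f1_space_sum X Y = \<lparr> points = Inl ` points X \<union> glue_right X Y ` points Y, base = Inl (base X) \<rparr>"

definition f1_sum ::
  "('v, 'e) pre_digraph \<Rightarrow> ('v, 'e, 'x) f1_rep \<Rightarrow> ('v, 'e, 'y) f1_rep \<Rightarrow> ('v, 'e, 'x + 'y) f1_rep" where
  "f1_sum Q V W = \<lparr>
     f1_obj = (\<lambda>i. f1_space_sum (f1_obj V i) (f1_obj W i)),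
     f1_map = (\<lambda>a. case_sum
       (\<lambda>x. Inl (f1_map V a x))
       (\<lambda>y. glue_right (f1_obj V (head Q a)) (f1_obj W (head Q a)) (f1_map W a y))) \<rparr>"

text \<open>
  The summands may be taken with the same element type as \<open>V\<close>, because every direct summand of \<open>V\<close>
  is isomorphic to a subrepresentation of \<open>V\<close>.  The same remark applies to \<open>k_indecomposable\<close> below.
\<close>

definition f1_indecomposable :: "('v, 'e) pre_digraph \<Rightarrow> ('v, 'e, 'x) f1_rep \<Rightarrow> bool" where
  "f1_indecomposable Q V \<longleftrightarrow> f1_nonzero Q V \<and>
     \<not> (\<exists>(X :: ('v, 'e, 'x) f1_rep) (Y :: ('v, 'e, 'x) f1_rep).
          f1_rep Q X \<and> f1_rep Q Y \<and> f1_nonzero Q X \<and> f1_nonzero Q Y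
          \<and> f1_iso Q V (f1_sum Q X Y))"

section \<open>Representations over a field\<close>

record ('v, 'e, 'k, 'm) k_rep =
  k_obj :: "'v \<Rightarrow> ('k, 'm) module"
  k_map :: "'e \<Rightarrow> 'm \<Rightarrow> 'm"

definition k_rep :: "'k ring \<Rightarrow> ('v, 'e) pre_digraph \<Rightarrow> ('v, 'e, 'k, 'm) k_rep \<Rightarrow> bool" where
  "k_rep K Q M \<longleftrightarrow> (\<forall>i \<in> verts Q. vectorspace K (k_obj M i))
     \<and> (\<forall>a \<in> arcs Q. linear_map K (k_obj M (tail Q a)) (k_obj M (head Q a)) (k_map M a))"

definition k_nonzero :: "('v, 'e) pre_digraph \<Rightarrow> ('v, 'e, 'k, 'm) k_rep \<Rightarrow> bool" where
  "k_nonzero Q M \<longleftrightarrow> (\<exists>i \<in> verts Q. carrier (k_obj M i) \<noteq> {\<zero>\<^bsub>k_obj M i\<^esub>})"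

definition k_iso :: "'k ring \<Rightarrow> ('v, 'e) pre_digraph \<Rightarrow> ('v, 'e, 'k, 'm) k_rep
    \<Rightarrow> ('v, 'e, 'k, 'n) k_rep \<Rightarrow> bool" where
  "k_iso K Q M N \<longleftrightarrow> (\<exists>\<phi>.
     (\<forall>i \<in> verts Q. linear_map K (k_obj M i) (k_obj N i) (\<phi> i)
        \<and> bij_betw (\<phi> i) (carrier (k_obj M i)) (carrier (k_obj N i)))
     \<and> (\<forall>a \<in> arcs Q. \<forall>x \<in> carrier (k_obj M (tail Q a)).
          \<phi> (head Q a) (k_map M a x) = k_map N a (\<phi> (tail Q a) x)))"

definition k_sum ::
  "('v, 'e, 'k, 'm) k_rep \<Rightarrow> ('v, 'e, 'k, 'n) k_rep \<Rightarrow> ('v, 'e, 'k, 'm \<times> 'n) k_rep" where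
  "k_sum M N = \<lparr>
     k_obj = (\<lambda>i. direct_sum (k_obj M i) (k_obj N i)),
     k_map = (\<lambda>a. map_prod (k_map M a) (k_map N a)) \<rparr>"

definition k_indecomposable :: "'k ring \<Rightarrow> ('v, 'e) pre_digraph \<Rightarrow> ('v, 'e, 'k, 'm) k_rep \<Rightarrow> bool" where
  "k_indecomposable K Q M \<longleftrightarrow> k_nonzero Q M \<and>
     \<not> (\<exists>(X :: ('v, 'e, 'k, 'm) k_rep) (Y :: ('v, 'e, 'k, 'm) k_rep).
          k_rep K Q X \<and> k_rep K Q Y \<and> k_nonzero Q X \<and> k_nonzero Q Y
          \<and> k_iso K Q M (k_sum X Y))"

section \<open>Scalar extension\<close>

text \<open>
  As \<open>nonzero_points\<close> is finite, the free vector space on it is the space of all functions from it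
  to \<open>K\<close> (extended by \<open>undefined\<close> outside).  The function \<open>f\<close> stands for the linear combination
  with coefficients \<open>f x\<close> of the basis vectors \<open>x\<close>, so the linear extension of an arrow map
  collects at \<open>y\<close> the coefficients of all basis vectors sent to \<open>y\<close>, and drops those sent to the
  base point.
\<close>

definition scalar_ext :: "'k ring \<Rightarrow> ('v, 'e) pre_digraph \<Rightarrow> ('v, 'e, 'x) f1_rep
    \<Rightarrow> ('v, 'e, 'k, 'x \<Rightarrow> 'k) k_rep" where
  "scalar_ext K Q V = \<lparr>
     k_obj = (\<lambda>i. ring.func_space K (nonzero_points (f1_obj V i))),
     k_map = (\<lambda>a f. \<lambda>y \<in> nonzero_points (f1_obj V (head Q a)).
       finsum K f {x \<in> nonzero_points (f1_obj V (tail Q a)). f1_map V a x = y}) \<rparr>"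

text \<open>
  HOL formulas cannot quantify over types, so the quantifier over all fields ranges over the fields
  whose carrier is a subset of a type \<open>'u\<close>, passed as an argument.  For \<open>'u = 'k + complex\<close> with a
  type variable \<open>'k\<close> these include a copy of every field on \<open>'k\<close> and of the complex numbers.
\<close>

definition absolutely_indecomposable ::
  "'u itself \<Rightarrow> ('v, 'e) pre_digraph \<Rightarrow> ('v, 'e, 'x) f1_rep \<Rightarrow> bool" where
  "absolutely_indecomposable _ Q V \<longleftrightarrow> f1_indecomposable Q V
     \<and> (\<forall>K :: 'u ring. field K \<longrightarrow> k_indecomposable K Q (scalar_ext K Q V))"

section \<open>Coefficient quivers and tensor products\<close>

definition coeff_quiver :: "('v, 'e) pre_digraph \<Rightarrow> ('v, 'e, 'x) f1_rep
    \<Rightarrow> ('v \<times> 'x, 'e \<times> ('v \<times> 'x) \<times> ('v \<times> 'x)) pre_digraph" where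
  "coeff_quiver Q V = \<lparr>
     verts = (SIGMA i : verts Q. nonzero_points (f1_obj V i)),
     arcs = {(a, (tail Q a, x), (head Q a, y)) | a x y. a \<in> arcs Q
       \<and> x \<in> nonzero_points (f1_obj V (tail Q a)) \<and> y \<in> nonzero_points (f1_obj V (head Q a))
       \<and> f1_map V a x = y},
     tail = (\<lambda>(a, v, w). v),
     head = (\<lambda>(a, v, w). w) \<rparr>"

text \<open>
  \<open>smash X Y v w\<close> is the class of \<open>(v, w)\<close> after collapsing
  \<open>points X \<times> {base Y} \<union> {base X} \<times> points Y\<close>; the collapsed subset is represented by
  \<open>(base X, base Y)\<close>, every other class by its only element.
\<close>

definition smash :: "'x f1_space \<Rightarrow> 'y f1_space \<Rightarrow> 'x \<Rightarrow> 'y \<Rightarrow> 'x \<times> 'y" where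
  "smash X Y v w = (if v = base X \<or> w = base Y then (base X, base Y) else (v, w))"

definition f1_space_tensor :: "'x f1_space \<Rightarrow> 'y f1_space \<Rightarrow> ('x \<times> 'y) f1_space" where
  "f1_space_tensor X Y = \<lparr>
     points = {smash X Y v w | v w. v \<in> points X \<and> w \<in> points Y},
     base = (base X, base Y) \<rparr>"

definition f1_tensor ::
  "('v, 'e) pre_digraph \<Rightarrow> ('v, 'e, 'x) f1_rep \<Rightarrow> ('v, 'e, 'y) f1_rep \<Rightarrow> ('v, 'e, 'x \<times> 'y) f1_rep" where
  "f1_tensor Q V W = \<lparr>
     f1_obj = (\<lambda>i. f1_space_tensor (f1_obj V i) (f1_obj W i)),
     f1_map = (\<lambda>a (v, w).
       smash (f1_obj V (head Q a)) (f1_obj W (head Q a)) (f1_map V a v) (f1_map W a w)) \<rparr>"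

text \<open>
  A vertex \<open>(i, (x, y))\<close> of the coefficient quiver of \<open>f1_tensor Q V W\<close> corresponds to the pair of
  vertices \<open>((i, x), (i, y))\<close>, and an arrow \<open>(a, s, t)\<close> of it to the pair of arrows
  \<open>((a, proj1_vert s, proj1_vert t), (a, proj2_vert s, proj2_vert t))\<close>.
\<close>

definition proj1_vert :: "'v \<times> ('x \<times> 'y) \<Rightarrow> 'v \<times> 'x" where
  "proj1_vert = (\<lambda>(i, (x, y)). (i, x))"

definition proj2_vert :: "'v \<times> ('x \<times> 'y) \<Rightarrow> 'v \<times> 'y" where
  "proj2_vert = (\<lambda>(i, (x, y)). (i, y))"

definition proj1_arc ::
  "'e \<times> ('v \<times> ('x \<times> 'y)) \<times> ('v \<times> ('x \<times> 'y)) \<Rightarrow> 'e \<times> ('v \<times> 'x) \<times> ('v \<times> 'x)" where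
  "proj1_arc = (\<lambda>(a, s, t). (a, proj1_vert s, proj1_vert t))"

definition proj2_arc ::
  "'e \<times> ('v \<times> ('x \<times> 'y)) \<times> ('v \<times> ('x \<times> 'y)) \<Rightarrow> 'e \<times> ('v \<times> 'y) \<times> ('v \<times> 'y)" where
  "proj2_arc = (\<lambda>(a, s, t). (a, proj2_vert s, proj2_vert t))"

section \<open>Covering components\<close>

definition quiver_morphism :: "('v, 'e) pre_digraph \<Rightarrow> ('w, 'f) pre_digraph
    \<Rightarrow> ('v \<Rightarrow> 'w) \<Rightarrow> ('e \<Rightarrow> 'f) \<Rightarrow> bool" where
  "quiver_morphism R R' p q \<longleftrightarrow> p \<in> verts R \<rightarrow> verts R' \<and> q \<in> arcs R \<rightarrow> arcs R'
     \<and> (\<forall>a \<in> arcs R. tail R' (q a) = p (tail R a) \<and> head R' (q a) = p (head R a))"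

definition covering_map :: "('v, 'e) pre_digraph \<Rightarrow> ('w, 'f) pre_digraph
    \<Rightarrow> ('v \<Rightarrow> 'w) \<Rightarrow> ('e \<Rightarrow> 'f) \<Rightarrow> bool" where
  "covering_map R R' p q \<longleftrightarrow> quiver_morphism R R' p q \<and>
     (\<forall>v \<in> verts R'. \<forall>v' \<in> verts R. p v' = v \<longrightarrow> (\<forall>a \<in> arcs R'.
        (tail R' a = v \<longrightarrow> (\<exists>!a'. a' \<in> arcs R \<and> q a' = a \<and> tail R a' = v')) \<and>
        (head R' a = v \<longrightarrow> (\<exists>!a'. a' \<in> arcs R \<and> q a' = a \<and> head R a' = v'))))"

text \<open>
  \<open>Digraph_Component.connected\<close> refers to the underlying undirected graph, and it excludes the
  empty quiver.
\<close>

definition connected_component :: "('v, 'e) pre_digraph \<Rightarrow> ('v, 'e) pre_digraph \<Rightarrow> bool" where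
  "connected_component R C \<longleftrightarrow> pre_digraph.max_subgraph R Digraph_Component.connected C"

definition covering_component :: "('v, 'e) pre_digraph \<Rightarrow> ('v, 'e, 'x) f1_rep \<Rightarrow> ('v, 'e, 'y) f1_rep
    \<Rightarrow> ('v \<times> ('x \<times> 'y), 'e \<times> ('v \<times> ('x \<times> 'y)) \<times> ('v \<times> ('x \<times> 'y))) pre_digraph \<Rightarrow> bool" where
  "covering_component Q V W C \<longleftrightarrow> connected_component (coeff_quiver Q (f1_tensor Q V W)) C
     \<and> covering_map C (coeff_quiver Q V) proj1_vert proj1_arc
     \<and> covering_map C (coeff_quiver Q W) proj2_vert proj2_arc"

end

theory Submission
  imports Defs "HOL-Algebra.Weak_Morphisms"
begin

text \<open>
  Fix an endomorphism \<open>e\<close> of the scalar extension \<open>V\<^sup>K\<close> and look at its matrix in the basis of nonzero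
  points of \<open>V\<close>. Compatibility with the arrow maps means that the entry at \<open>(x, y)\<close> is constant along
  the arrows of \<open>\<Gamma>\<^bsub>V \<otimes> V\<^esub>\<close> and vanishes on every component that contains a pair \<open>(x, y)\<close> with an
  unmatched arrow out of \<open>y\<close> or into \<open>x\<close>. So the support of \<open>e\<close> lies in the largest relation
  \<open>similar\<close> that matches these arrows. This relation is a preorder, and its symmetric part \<open>bisimilar\<close>
  matches all arrows of both elements. Matching all arrows is precisely what makes the two projections
  of a component covering maps, so the covering components are the components consisting of bisimilar
  pairs. The diagonal is one of them, since \<open>V\<close> is indecomposable and \<open>\<Gamma>\<^bsub>V\<^esub>\<close> therefore connected.
  Hence there is exactly one covering component iff bisimilar elements are equal; call \<open>V\<close> rigid in
  that case (\<open>rigid_iff_unique_covering_component\<close>).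

  If \<open>V\<close> is rigid, \<open>similar\<close> is a partial order. Every endomorphism of \<open>V\<^sup>K\<close> is then triangular, and its
  diagonal is constant because \<open>\<Gamma>\<^bsub>V\<^esub>\<close> is connected, so it has at most one eigenvalue. The projection
  onto a proper direct summand has the eigenvalues \<open>0\<close> and \<open>1\<close>, so \<open>V\<^sup>K\<close> is indecomposable, over any
  field \<open>K\<close> (\<open>rigid_imp_scalar_ext_indecomposable\<close>).

  If \<open>V\<close> is not rigid, replace each coordinate of a vector by the average over the bisimilarity class.
  Arrow maps carry classes bijectively to classes wherever they do not vanish, so this is an
  endomorphism. It is idempotent, and it is neither zero nor the identity as soon as some class has two
  elements. Hence it splits \<open>V\<^sup>K\<close> (\<open>scalar_ext_indecomposable_imp_rigid\<close>). Averaging divides by the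
  sizes of the classes, which is possible in characteristic zero, in particular over \<open>\<complex>\<close>.

  Thus each of the three statements is equivalent to rigidity. For absolute indecomposability, a field
  of characteristic zero is provided by the copy of \<open>\<complex>\<close> in the sum type.
\<close>

section \<open>Similarity of basis elements\<close>

locale f1_quiver_rep =
  fixes Q :: "('v, 'e) pre_digraph" and V :: "('v, 'e, 'x) f1_rep"
  assumes fin_Q: "fin_digraph Q"
    and rep_V: "f1_rep Q V"
begin

sublocale fin_digraph Q
  by (rule fin_Q)

abbreviation basis :: "'v \<Rightarrow> 'x set" where
  "basis i \<equiv> nonzero_points (f1_obj V i)"

text \<open>
  The arrows of the coefficient quiver, with their end points named by basis elements only. Since the
  arrow maps are injective away from the base point, every label \<open>a\<close> is a partial bijection.
\<close>

definition arrow :: "'e \<Rightarrow> 'x \<Rightarrow> 'x \<Rightarrow> bool" where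
  "arrow a x y \<longleftrightarrow> a \<in> arcs Q \<and> x \<in> basis (tail Q a) \<and> y \<in> basis (head Q a) \<and> f1_map V a x = y"

lemma finite_basis: "i \<in> verts Q \<Longrightarrow> finite (basis i)"
  using rep_V by (auto simp: f1_rep_def f1_space_def nonzero_points_def)

lemma arrowD:
  assumes "arrow a x y"
  shows "a \<in> arcs Q" "x \<in> basis (tail Q a)" "y \<in> basis (head Q a)"
    "tail Q a \<in> verts Q" "head Q a \<in> verts Q"
  using assms by (auto simp: arrow_def)

lemma arrow_functional: "arrow a x y \<Longrightarrow> arrow a x z \<Longrightarrow> y = z"
  by (simp add: arrow_def)

lemma arrow_injective:
  assumes "arrow a x z" "arrow a y z"
  shows "x = y"
proof -
  have "inj_on (f1_map V a)
      (points (f1_obj V (tail Q a)) - f1_map V a -` {base (f1_obj V (head Q a))})"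
    using rep_V arrowD(1)[OF assms(1)] by (auto simp: f1_rep_def f1_linear_def)
  then show ?thesis
    using assms by (auto simp: arrow_def nonzero_points_def inj_on_def)
qed

text \<open>
  If \<open>e\<close> is an endomorphism of the scalar extension, the pairs \<open>(x, y)\<close> such that \<open>y\<close> occurs in
  \<open>e x\<close> form a simulation: an arrow out of \<open>y\<close> can only be matched by an arrow out of \<open>x\<close>, and an
  arrow into \<open>x\<close> only by an arrow into \<open>y\<close>. The direction of the two clauses records this asymmetry.
  The maximal simulation \<open>similar\<close> is the union of all components of \<open>\<Gamma>\<^bsub>V \<otimes> V\<^esub>\<close> that carry an
  endomorphism, and \<open>bisimilar\<close> will turn out to be the union of the covering components.
\<close>

definition simulation :: "('v \<Rightarrow> 'x \<Rightarrow> 'x \<Rightarrow> bool) \<Rightarrow> bool" where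
  "simulation R \<longleftrightarrow>
     (\<forall>i x y. R i x y \<longrightarrow> i \<in> verts Q \<and> x \<in> basis i \<and> y \<in> basis i) \<and>
     (\<forall>a x y y'. R (tail Q a) x y \<longrightarrow> arrow a y y' \<longrightarrow> (\<exists>x'. arrow a x x' \<and> R (head Q a) x' y')) \<and>
     (\<forall>a x x' y'. R (head Q a) x' y' \<longrightarrow> arrow a x x' \<longrightarrow> (\<exists>y. arrow a y y' \<and> R (tail Q a) x y))"

definition similar :: "'v \<Rightarrow> 'x \<Rightarrow> 'x \<Rightarrow> bool" where
  "similar i x y \<longleftrightarrow> (\<exists>R. simulation R \<and> R i x y)"

definition bisimilar :: "'v \<Rightarrow> 'x \<Rightarrow> 'x \<Rightarrow> bool" where
  "bisimilar i x y \<longleftrightarrow> similar i x y \<and> similar i y x"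

lemma similarI: "simulation R \<Longrightarrow> R i x y \<Longrightarrow> similar i x y"
  by (auto simp: similar_def)

lemma similarD:
  assumes "similar i x y"
  shows "i \<in> verts Q" "x \<in> basis i" "y \<in> basis i"
  using assms by (auto simp: similar_def simulation_def)

lemma similar_forward:
  assumes "similar (tail Q a) x y" "arrow a y y'"
  obtains x' where "arrow a x x'" "similar (head Q a) x' y'"
  using assms unfolding similar_def simulation_def by metis

lemma similar_backward:
  assumes "similar (head Q a) x' y'" "arrow a x x'"
  obtains y where "arrow a y y'" "similar (tail Q a) x y"
  using assms unfolding similar_def simulation_def by metis

lemma similar_refl: "i \<in> verts Q \<Longrightarrow> x \<in> basis i \<Longrightarrow> similar i x x"
  by (rule similarI[of "\<lambda>i x y. i \<in> verts Q \<and> x \<in> basis i \<and> x = y"])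
    (auto simp: simulation_def dest: arrowD)

text \<open>
  Simulations compose, as endomorphisms do.
\<close>

lemma similar_trans:
  assumes "similar i x y" "similar i y z"
  shows "similar i x z"
proof (rule similarI[of "\<lambda>i x z. \<exists>y. similar i x y \<and> similar i y z"])
  show "simulation (\<lambda>i x z. \<exists>y. similar i x y \<and> similar i y z)"
    unfolding simulation_def
  proof (intro conjI allI impI)
    fix a x z z'
    assume "\<exists>y. similar (tail Q a) x y \<and> similar (tail Q a) y z" "arrow a z z'"
    then show "\<exists>x'. arrow a x x' \<and> (\<exists>y. similar (head Q a) x' y \<and> similar (head Q a) y z')"
      by (metis similar_forward)
  next
    fix a x x' z'
    assume "\<exists>y. similar (head Q a) x' y \<and> similar (head Q a) y z'" "arrow a x x'"
    then show "\<exists>z. arrow a z z' \<and> (\<exists>y. similar (tail Q a) x y \<and> similar (tail Q a) y z)"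
      by (metis similar_backward)
  qed (auto dest: similarD)
qed (use assms in auto)

lemma bisimilarD:
  assumes "bisimilar i x y"
  shows "i \<in> verts Q" "x \<in> basis i" "y \<in> basis i"
  using assms by (auto simp: bisimilar_def dest: similarD)

lemma bisimilar_refl: "i \<in> verts Q \<Longrightarrow> x \<in> basis i \<Longrightarrow> bisimilar i x x"
  by (simp add: bisimilar_def similar_refl)

lemma bisimilar_sym: "bisimilar i x y \<longleftrightarrow> bisimilar i y x"
  by (auto simp: bisimilar_def)

lemma bisimilar_trans: "bisimilar i x y \<Longrightarrow> bisimilar i y z \<Longrightarrow> bisimilar i x z"
  by (auto simp: bisimilar_def intro: similar_trans)

text \<open>
  Being the symmetric part of \<open>similar\<close>, bisimilarity transports arrows in both directions. This
  needs determinism: matching an arrow of \<open>x\<close> at \<open>y\<close> and then matching back returns to the arrow at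
  \<open>x\<close>, so both halves of the relation hold for the same pair of end points.
\<close>

lemma bisimilar_forward:
  assumes "bisimilar (tail Q a) x y" "arrow a x x'"
  obtains y' where "arrow a y y'" "bisimilar (head Q a) x' y'"
proof -
  obtain y' where y': "arrow a y y'" "similar (head Q a) y' x'"
    using assms by (auto simp: bisimilar_def elim: similar_forward)
  moreover obtain x'' where "arrow a x x''" "similar (head Q a) x'' y'"
    using assms y' by (auto simp: bisimilar_def elim: similar_forward)
  ultimately show ?thesis
    using that assms(2) arrow_functional by (metis bisimilar_def)
qed

lemma bisimilar_backward:
  assumes "bisimilar (head Q a) x' y'" "arrow a x x'"
  obtains y where "arrow a y y'" "bisimilar (tail Q a) x y"
proof -
  obtain y where y: "arrow a y y'" "similar (tail Q a) x y"
    using assms by (auto simp: bisimilar_def elim: similar_backward)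
  moreover obtain w where "arrow a w x'" "similar (tail Q a) y w"
    using assms y by (auto simp: bisimilar_def elim: similar_backward)
  ultimately show ?thesis
    using that assms(2) arrow_injective by (metis bisimilar_def)
qed

text \<open>
  The combinatorial condition through which the field-dependent statements are compared with the
  one about covering components.
\<close>

definition rigid :: bool where
  "rigid \<longleftrightarrow> (\<forall>i x y. bisimilar i x y \<longrightarrow> x = y)"

text \<open>
  Rigidity makes the preorder \<open>similar\<close> antisymmetric, so nonempty finite sets have minimal elements.
\<close>

lemma similar_minimal_element:
  assumes "rigid" "i \<in> verts Q" "S \<subseteq> basis i" "S \<noteq> {}"
  obtains x where "x \<in> S" "\<And>y. y \<in> S \<Longrightarrow> similar i y x \<Longrightarrow> y = x"
proof -
  define R where "R x y \<longleftrightarrow> similar i x y \<and> x \<noteq> y" for x y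
  have antisym: "x = y" if "similar i x y" "similar i y x" for x y
    using that \<open>rigid\<close> by (auto simp: rigid_def bisimilar_def)
  have "\<exists>m\<in>S. \<forall>x\<in>S. x \<noteq> m \<longrightarrow> \<not> R x m"
  proof (rule Finite_Set.bex_min_element)
    show "finite S"
      using assms finite_basis finite_subset by blast
    show "asymp_on S R"
      by (intro asymp_onI) (auto simp: R_def dest: antisym)
    show "transp_on S R"
      by (intro transp_onI) (auto simp: R_def dest: antisym intro: similar_trans)
  qed (fact \<open>S \<noteq> {}\<close>)
  then show ?thesis
    using that by (auto simp: R_def)
qed

section \<open>Indecomposable representations have connected coefficient quivers\<close>

lemma map_basis_cases:
  assumes "a \<in> arcs Q" "x \<in> points (f1_obj V (tail Q a))"
  obtains "f1_map V a x = base (f1_obj V (head Q a))" | "arrow a x (f1_map V a x)"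
proof -
  have "f1_map V a x \<in> points (f1_obj V (head Q a))"
    "f1_map V a (base (f1_obj V (tail Q a))) = base (f1_obj V (head Q a))"
    using rep_V assms by (auto simp: f1_rep_def f1_linear_def)
  with assms show ?thesis
    using that by (auto simp: arrow_def nonzero_points_def)
qed

definition subrep :: "('v \<Rightarrow> 'x set) \<Rightarrow> ('v, 'e, 'x) f1_rep" where
  "subrep S = \<lparr>f1_obj = (\<lambda>i. \<lparr>points = insert (base (f1_obj V i)) (S i), base = base (f1_obj V i)\<rparr>),
     f1_map = f1_map V\<rparr>"

lemma subrep_is_rep:
  assumes "\<And>i. S i \<subseteq> basis i" and "\<And>a x y. arrow a x y \<Longrightarrow> x \<in> S (tail Q a) \<Longrightarrow> y \<in> S (head Q a)"
  shows "f1_rep Q (subrep S)"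
  unfolding f1_rep_def
proof (intro conjI ballI)
  fix i assume "i \<in> verts Q"
  then show "f1_space (f1_obj (subrep S) i)"
    using finite_basis assms(1) by (auto simp: f1_space_def subrep_def intro: finite_subset)
next
  fix a assume a: "a \<in> arcs Q"
  let ?s = "tail Q a" and ?t = "head Q a"
  have base: "f1_map V a (base (f1_obj V ?s)) = base (f1_obj V ?t)"
    and inj: "inj_on (f1_map V a) (points (f1_obj V ?s) - f1_map V a -` {base (f1_obj V ?t)})"
    using rep_V a by (auto simp: f1_rep_def f1_linear_def)
  have sub: "insert (base (f1_obj V ?s)) (S ?s) \<subseteq> points (f1_obj V ?s)"
    using assms(1)[of ?s] rep_V a wellformed(1)[OF a]
    by (auto simp: f1_rep_def f1_space_def nonzero_points_def)
  have "f1_map V a x \<in> insert (base (f1_obj V ?t)) (S ?t)" if "x \<in> S ?s" for x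
    using map_basis_cases[OF a, of x] assms(2) sub that by blast
  with base have "f1_map V a \<in> insert (base (f1_obj V ?s)) (S ?s) \<rightarrow> insert (base (f1_obj V ?t)) (S ?t)"
    by auto
  moreover have "inj_on (f1_map V a)
      (insert (base (f1_obj V ?s)) (S ?s) - f1_map V a -` {base (f1_obj V ?t)})"
    using inj by (rule inj_on_subset) (use sub in auto)
  ultimately show "f1_linear (f1_obj (subrep S) ?s) (f1_obj (subrep S) ?t) (f1_map (subrep S) a)"
    using base by (simp add: f1_linear_def subrep_def)
qed

lemma subrep_nonzero:
  assumes "\<And>i. S i \<subseteq> basis i"
  shows "f1_nonzero Q (subrep S) \<longleftrightarrow> (\<exists>i\<in>verts Q. S i \<noteq> {})"
proof -
  have "base (f1_obj V i) \<notin> S i" for i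
    using assms[of i] by (auto simp: nonzero_points_def)
  then show ?thesis
    by (auto simp: f1_nonzero_def subrep_def nonzero_points_def)
qed

text \<open>
  A set of basis elements that no arrow enters or leaves splits off: the arrow maps respect both the
  set and its complement.
\<close>

lemma iso_sum_of_complementary_subreps:
  assumes S: "\<And>i. S i \<subseteq> basis i"
    and closed: "\<And>a x y. arrow a x y \<Longrightarrow> x \<in> S (tail Q a) \<longleftrightarrow> y \<in> S (head Q a)"
  shows "f1_iso Q V (f1_sum Q (subrep S) (subrep (\<lambda>i. basis i - S i)))"
proof -
  let ?X = "subrep S" and ?Y = "subrep (\<lambda>i. basis i - S i)"
  define \<phi> where "\<phi> i x = (if x \<in> basis i - S i then Inr x else Inl x)" for i x
  have base_notin: "base (f1_obj V i) \<notin> S i" for i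
    using S[of i] by (auto simp: nonzero_points_def)
  have sum_points: "points (f1_obj (f1_sum Q ?X ?Y) i)
      = Inl ` insert (base (f1_obj V i)) (S i) \<union> Inr ` (basis i - S i)" for i
    by (auto simp: f1_sum_def f1_space_sum_def subrep_def glue_right_def nonzero_points_def)
  have sum_base: "base (f1_obj (f1_sum Q ?X ?Y) i) = Inl (base (f1_obj V i))" for i
    by (simp add: f1_sum_def f1_space_sum_def subrep_def)
  have bij: "bij_betw (\<phi> i) (points (f1_obj V i)) (points (f1_obj (f1_sum Q ?X ?Y) i))"
    if "i \<in> verts Q" for i
  proof -
    have "base (f1_obj V i) \<in> points (f1_obj V i)"
      using rep_V that by (auto simp: f1_rep_def f1_space_def)
    with S[of i] have points: "points (f1_obj V i)
        = insert (base (f1_obj V i)) (S i) \<union> (basis i - S i)"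
      by (auto simp: nonzero_points_def)
    have "inj_on (\<phi> i) (points (f1_obj V i))"
      by (auto simp: \<phi>_def inj_on_def split: if_splits)
    moreover have "\<phi> i ` points (f1_obj V i) = points (f1_obj (f1_sum Q ?X ?Y) i)"
      unfolding points sum_points image_Un
      by (intro arg_cong2[of _ _ _ _ "(\<union>)"] image_cong) (auto simp: \<phi>_def nonzero_points_def)
    ultimately show ?thesis
      by (simp add: bij_betw_def)
  qed
  have "f1_linear (f1_obj V i) (f1_obj (f1_sum Q ?X ?Y) i) (\<phi> i)" if "i \<in> verts Q" for i
    unfolding f1_linear_def
  proof (intro conjI)
    show "\<phi> i \<in> points (f1_obj V i) \<rightarrow> points (f1_obj (f1_sum Q ?X ?Y) i)"
      using bij[OF that] by (auto simp: bij_betw_def)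
    show "\<phi> i (base (f1_obj V i)) = base (f1_obj (f1_sum Q ?X ?Y) i)"
      unfolding sum_base by (simp add: \<phi>_def nonzero_points_def)
    show "inj_on (\<phi> i) (points (f1_obj V i) - \<phi> i -` {base (f1_obj (f1_sum Q ?X ?Y) i)})"
      using bij[OF that] by (auto simp: bij_betw_def intro: inj_on_subset)
  qed
  moreover have "\<phi> (head Q a) (f1_map V a x) = f1_map (f1_sum Q ?X ?Y) a (\<phi> (tail Q a) x)"
    if a: "a \<in> arcs Q" and x: "x \<in> points (f1_obj V (tail Q a))" for a x
    using a x
  proof (cases rule: map_basis_cases)
    case 1
    then show ?thesis
      using base_notin[of "head Q a"]
      by (auto simp: \<phi>_def f1_sum_def subrep_def glue_right_def nonzero_points_def)
  next
    case 2
    then show ?thesis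
      using closed[OF 2] arrowD[OF 2] base_notin[of "head Q a"]
      by (auto simp: \<phi>_def f1_sum_def subrep_def glue_right_def nonzero_points_def)
  qed
  ultimately show ?thesis
    using bij unfolding f1_iso_def by blast
qed

text \<open>
  Connectedness in the form of a propagation principle: a property that is invariant along arrows in
  both directions holds everywhere once it holds somewhere.
\<close>

lemma indecomposable_imp_connected:
  assumes "f1_indecomposable Q V"
    and S: "\<And>i. S i \<subseteq> basis i"
    and closed: "\<And>a x y. arrow a x y \<Longrightarrow> x \<in> S (tail Q a) \<longleftrightarrow> y \<in> S (head Q a)"
    and "j \<in> verts Q" "S j \<noteq> {}" "i \<in> verts Q"
  shows "S i = basis i"
proof (rule ccontr)
  assume "S i \<noteq> basis i"
  then have "f1_nonzero Q (subrep (\<lambda>i. basis i - S i))"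
    using S[of i] \<open>i \<in> verts Q\<close> by (subst subrep_nonzero) auto
  moreover have "f1_nonzero Q (subrep S)"
    using S assms(4,5) by (subst subrep_nonzero) auto
  moreover have "f1_rep Q (subrep S)" "f1_rep Q (subrep (\<lambda>i. basis i - S i))"
    using S closed by (auto intro!: subrep_is_rep dest: arrowD)
  moreover have "f1_iso Q V (f1_sum Q (subrep S) (subrep (\<lambda>i. basis i - S i)))"
    using S closed by (rule iso_sum_of_complementary_subreps)
  ultimately show False
    using assms(1) unfolding f1_indecomposable_def by blast
qed

end

section \<open>Connected components of a quiver\<close>

abbreviation walk_related :: "('v, 'e) pre_digraph \<Rightarrow> 'v \<Rightarrow> 'v \<Rightarrow> bool" where
  "walk_related R u v \<equiv> u \<rightarrow>\<^sup>*\<^bsub>mk_symmetric R\<^esub> v"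

lemma walk_related_sym:
  assumes "wf_digraph R" "walk_related R u v"
  shows "walk_related R v u"
proof -
  interpret pair_wf_digraph "mk_symmetric R"
    using assms(1) by (rule wf_digraph.wellformed_mk_symmetric)
  show ?thesis
    using assms(2) by (rule symmetric_reachable[OF symmetric_mk_symmetric])
qed

lemma walk_related_trans:
  assumes "wf_digraph R" "walk_related R u v" "walk_related R v w"
  shows "walk_related R u w"
proof -
  interpret pair_wf_digraph "mk_symmetric R"
    using assms(1) by (rule wf_digraph.wellformed_mk_symmetric)
  show ?thesis
    using reachable_trans assms(2,3) by simp
qed

lemma walk_related_refl: "v \<in> verts R \<Longrightarrow> walk_related R v v"
  by (simp add: reachable_def rtrancl_on_refl)

lemma walk_related_arc:
  assumes "wf_digraph R" "a \<in> arcs R"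
  shows "walk_related R (tail R a) (head R a)"
proof -
  interpret wf_digraph R by fact
  show ?thesis
    by (intro reachable_mk_symmetricI reachable_adjI in_arcs_imp_in_arcs_ends assms(2))
qed

lemma walk_related_mono:
  assumes "subgraph H R" "walk_related H u v"
  shows "walk_related R u v"
  using pre_digraph.reachable_mono[OF assms(2) subgraph_mk_symmetric[OF assms(1)]] .

lemma walk_related_closed:
  assumes "walk_related R u v" "u \<in> S"
    and "\<And>a. a \<in> arcs R \<Longrightarrow> tail R a \<in> S \<longleftrightarrow> head R a \<in> S"
  shows "v \<in> S"
  using assms(1,2) unfolding reachable_def
proof (induction rule: rtrancl_on_induct)
  case (step v w)
  then obtain a where "a \<in> arcs R" "(v, w) \<in> {(tail R a, head R a), (head R a, tail R a)}"
    by (auto simp: parcs_mk_symmetric)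
  with step assms(3)[of a] show ?case
    by auto
qed auto

lemma connected_from_vertexI:
  assumes "wf_digraph R" "u \<in> verts R" "\<And>v. v \<in> verts R \<Longrightarrow> walk_related R u v"
  shows "Digraph_Component.connected R"
  unfolding connected_def
proof (rule strongly_connectedI)
  fix v w assume "v \<in> verts (with_proj (mk_symmetric R))" "w \<in> verts (with_proj (mk_symmetric R))"
  then show "walk_related R v w"
    using walk_related_trans[OF assms(1)] walk_related_sym[OF assms(1)] assms(3)
    by (metis pverts_mk_symmetric with_proj_simps(1))
qed (use assms(2) in auto)

lemma connected_imp_walk_related:
  "Digraph_Component.connected R \<Longrightarrow> u \<in> verts R \<Longrightarrow> v \<in> verts R \<Longrightarrow> walk_related R u v"
  unfolding connected_def by auto

lemma connected_componentD:
  assumes "connected_component R C"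
  shows "subgraph C R" "Digraph_Component.connected C" "wf_digraph C" "wf_digraph R"
    "verts C \<subseteq> verts R" "arcs C \<subseteq> arcs R" "tail C = tail R" "head C = head R" "verts C \<noteq> {}"
proof -
  show sub: "subgraph C R" and conn: "Digraph_Component.connected C"
    using assms by (simp_all add: connected_component_def pre_digraph.max_subgraph_def)
  show "verts C \<noteq> {}"
    using conn by (simp add: connected_def strongly_connected_def)
  show "wf_digraph C" "wf_digraph R" "verts C \<subseteq> verts R" "arcs C \<subseteq> arcs R"
    "tail C = tail R" "head C = head R"
    using sub by (simp_all add: subgraph_def compatible_def)
qed

text \<open>
  Adjoining to a component an arc that touches it, together with the ends of the arc, keeps it
  connected; so maximality leaves no such arc outside.
\<close>

lemma connected_component_absorbs_arc:
  assumes "connected_component R C" "a \<in> arcs R" "tail R a \<in> verts C \<or> head R a \<in> verts C"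
  shows "a \<in> arcs C"
proof -
  note C = connected_componentD[OF assms(1)]
  interpret wf_digraph R by fact
  define H where "H = C\<lparr>verts := {tail R a, head R a} \<union> verts C, arcs := insert a (arcs C)\<rparr>"
  have H: "verts H = {tail R a, head R a} \<union> verts C" "arcs H = insert a (arcs C)"
    "tail H = tail R" "head H = head R"
    by (simp_all add: H_def C)
  have wf_H: "wf_digraph H"
    using wf_digraph.wellformed[OF C(3)] by unfold_locales (auto simp: H C)
  have CH: "subgraph C H"
    by (intro subgraphI) (auto simp: H C wf_H compatible_def)
  have HR: "subgraph H R"
    using C(5,6) assms(2) by (intro subgraphI) (auto simp: H wf_H compatible_def C(4))
  obtain u where u: "u \<in> verts C" "u = tail R a \<or> u = head R a"
    using assms(3) by blast
  have "Digraph_Component.connected H"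
  proof (rule connected_from_vertexI[OF wf_H])
    show "u \<in> verts H"
      using u by (simp add: H)
    have arc: "walk_related H (tail R a) (head R a)"
      using walk_related_arc[OF wf_H, of a] by (simp add: H)
    have verts: "walk_related H u v" if "v \<in> verts C" for v
      using that walk_related_mono[OF CH connected_imp_walk_related[OF C(2) u(1)]] by blast
    show "walk_related H u v" if "v \<in> verts H" for v
      using that u arc walk_related_sym[OF wf_H arc] verts
        walk_related_refl[of "tail R a" H] walk_related_refl[of "head R a" H]
      by (auto simp: H)
  qed
  then have "H = C"
    using assms(1) CH HR unfolding connected_component_def pre_digraph.max_subgraph_def by blast
  with H(2) show ?thesis
    by auto
qed

lemma connected_component_verts:
  assumes "connected_component R C" "u \<in> verts C"
  shows "verts C = {v. walk_related R u v}"
proof -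
  note C = connected_componentD[OF assms(1)]
  have "v \<in> verts C" if "walk_related R u v" for v
    using that assms(2)
  proof (rule walk_related_closed)
    fix a assume "a \<in> arcs R"
    then show "tail R a \<in> verts C \<longleftrightarrow> head R a \<in> verts C"
      using connected_component_absorbs_arc[OF assms(1)] wf_digraph.wellformed[OF C(3)] C(7,8)
      by metis
  qed
  moreover have "walk_related R u v" if "v \<in> verts C" for v
    using walk_related_mono[OF C(1) connected_imp_walk_related[OF C(2) assms(2) that]] .
  ultimately show ?thesis
    by blast
qed

lemma connected_component_arcs:
  assumes "connected_component R C"
  shows "arcs C = {a \<in> arcs R. tail R a \<in> verts C}"
  using connected_componentD[OF assms] connected_component_absorbs_arc[OF assms]
    wf_digraph.tail_in_verts[of C] by auto

lemma connected_component_unique: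
  assumes "connected_component R C" "connected_component R D" "u \<in> verts C" "u \<in> verts D"
  shows "C = D"
proof (rule pre_digraph.equality)
  show "verts C = verts D"
    using connected_component_verts[OF assms(1,3)] connected_component_verts[OF assms(2,4)] by simp
  then show "arcs C = arcs D"
    using assms(1,2)[THEN connected_component_arcs] by simp
qed (use connected_componentD[OF assms(1)] connected_componentD[OF assms(2)] in auto)

text \<open>
  The component is the induced subquiver on everything reachable from \<open>u\<close> in the underlying
  undirected graph; a larger connected subquiver could only contain reachable vertices again.
\<close>

lemma connected_component_exists:
  assumes "wf_digraph R" "u \<in> verts R"
  obtains C where "connected_component R C" "u \<in> verts C"
proof -
  interpret wf_digraph R by fact
  interpret S: pair_wf_digraph "mk_symmetric R"
    by (rule wellformed_mk_symmetric)
  define C where "C = R \<restriction> {v. walk_related R u v}"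
  have sub: "{v. walk_related R u v} \<subseteq> verts R"
    using S.reachable_in_verts(2) by fastforce
  have C: "subgraph C R" "wf_digraph C"
    using subgraph_induce_subgraphI[OF sub] wellformed_induce_subgraph by (auto simp: C_def)
  have u: "u \<in> verts C"
    using walk_related_refl[OF assms(2)] by (simp add: C_def)
  have step: "walk_related R u (tail R a) \<longleftrightarrow> walk_related R u (head R a)" if "a \<in> arcs R" for a
    using walk_related_arc[OF assms(1) that] walk_related_sym[OF assms(1)]
      walk_related_trans[OF assms(1)] by blast
  have conn: "Digraph_Component.connected C"
  proof (rule connected_from_vertexI[OF C(2) u])
    fix v assume "v \<in> verts C"
    then have "walk_related R u v"
      by (simp add: C_def)
    moreover have "u \<in> {v. walk_related R u v \<and> walk_related C u v}"
      using walk_related_refl[OF assms(2)] walk_related_refl[OF u] by simp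
    ultimately have "v \<in> {v. walk_related R u v \<and> walk_related C u v}"
    proof (rule walk_related_closed)
      fix a assume a: "a \<in> arcs R"
      have "walk_related C u (tail R a) \<longleftrightarrow> walk_related C u (head R a)" if "walk_related R u (tail R a)"
      proof -
        have "walk_related C (tail C a) (head C a)"
          using a that step[OF a] by (intro walk_related_arc[OF C(2)]) (simp add: C_def)
        then have "walk_related C (tail R a) (head R a)"
          by (simp add: C_def)
        then show ?thesis
          using walk_related_sym[OF C(2)] walk_related_trans[OF C(2)] by blast
      qed
      then show "tail R a \<in> {v. walk_related R u v \<and> walk_related C u v} \<longleftrightarrow>
          head R a \<in> {v. walk_related R u v \<and> walk_related C u v}"
        using step[OF a] by auto
    qed
    then show "walk_related C u v"
      by simp
  qed
  have "H = C" if "subgraph C H" "subgraph H R" "Digraph_Component.connected H" for H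
  proof -
    have CH: "verts C \<subseteq> verts H" "arcs C \<subseteq> arcs H" "tail H = tail C" "head H = head C"
      using that(1) by (auto elim!: subgraphE simp: compatible_def)
    have HR: "arcs H \<subseteq> arcs R" "wf_digraph H"
      using that(2) by (auto elim!: subgraphE)
    have "v \<in> verts C" if "v \<in> verts H" for v
      using walk_related_mono[OF \<open>subgraph H R\<close> connected_imp_walk_related[OF \<open>connected H\<close> _ that]]
        u CH(1) by (auto simp: C_def)
    with CH have verts: "verts H = verts C"
      by auto
    have "arcs H \<subseteq> arcs C"
    proof
      fix a assume "a \<in> arcs H"
      then show "a \<in> arcs C"
        using wf_digraph.wellformed[OF HR(2), of a] HR(1) verts CH by (auto simp: C_def)
    qed
    with CH verts show ?thesis
      by (intro pre_digraph.equality) auto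
  qed
  then have "connected_component R C"
    using C(1) conn unfolding connected_component_def pre_digraph.max_subgraph_def by blast
  with u that show ?thesis
    by blast
qed

section \<open>Covering components and bisimilarity\<close>

context f1_quiver_rep
begin

abbreviation square_quiver where
  "square_quiver \<equiv> coeff_quiver Q (f1_tensor Q V V)"

definition pair_arrow :: "'e \<Rightarrow> 'x \<times> 'x \<Rightarrow> 'x \<times> 'x \<Rightarrow> bool" where
  "pair_arrow a u u' \<longleftrightarrow> arrow a (fst u) (fst u') \<and> arrow a (snd u) (snd u')"

lemma pair_arrow_functional: "pair_arrow a u u' \<Longrightarrow> pair_arrow a u w' \<Longrightarrow> u' = w'"
  by (auto simp: pair_arrow_def prod_eq_iff intro: arrow_functional)

lemma pair_arrow_injective: "pair_arrow a u u' \<Longrightarrow> pair_arrow a w u' \<Longrightarrow> u = w"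
  by (auto simp: pair_arrow_def prod_eq_iff intro: arrow_injective)

lemma basis_tensor: "nonzero_points (f1_obj (f1_tensor Q V V) i) = basis i \<times> basis i"
  by (auto simp: f1_tensor_def f1_space_tensor_def nonzero_points_def smash_def)

lemma verts_coeff_quiver: "verts (coeff_quiver Q V) = (SIGMA i : verts Q. basis i)"
  by (simp add: coeff_quiver_def)

lemma verts_square_quiver: "verts square_quiver = (SIGMA i : verts Q. basis i \<times> basis i)"
  by (simp add: coeff_quiver_def basis_tensor)

lemma coeff_quiver_ends:
  "tail (coeff_quiver Q W) = (\<lambda>(a, v, w). v)" "head (coeff_quiver Q W) = (\<lambda>(a, v, w). w)"
  by (simp_all add: coeff_quiver_def)

lemma arcs_coeff_quiver:
  "arcs (coeff_quiver Q V) = {(a, (tail Q a, x), (head Q a, x')) | a x x'. arrow a x x'}"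
  by (auto simp: coeff_quiver_def arrow_def)

lemma arcs_square_quiver:
  "arcs square_quiver = {(a, (tail Q a, u), (head Q a, u')) | a u u'. pair_arrow a u u'}"
proof -
  have map: "f1_map (f1_tensor Q V V) a u = u' \<longleftrightarrow>
      f1_map V a (fst u) = fst u' \<and> f1_map V a (snd u) = snd u'"
    if "u' \<in> basis (head Q a) \<times> basis (head Q a)" for a u u'
    using that by (cases u; cases u') (auto simp: f1_tensor_def smash_def nonzero_points_def)
  have "a \<in> arcs Q \<and> u \<in> basis (tail Q a) \<times> basis (tail Q a) \<and>
      u' \<in> basis (head Q a) \<times> basis (head Q a) \<and> f1_map (f1_tensor Q V V) a u = u'
    \<longleftrightarrow> pair_arrow a u u'" for a u u'
    using map[of u' a u] by (auto simp: pair_arrow_def arrow_def mem_Times_iff)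
  then show ?thesis
    by (simp add: coeff_quiver_def basis_tensor)
qed

lemma wf_square_quiver: "wf_digraph square_quiver"
  by unfold_locales
    (auto simp: arcs_square_quiver verts_square_quiver coeff_quiver_ends pair_arrow_def
      mem_Times_iff dest: arrowD)

text \<open>
  Uniqueness of lifts along a projection is automatic, because the pairs of arrows are again partial
  bijections. Existence is what matters, and as a component absorbs every arc that touches it, the
  lift only has to exist in \<open>\<Gamma>\<^bsub>V \<otimes> V\<^esub>\<close>. Stating this for a map \<open>\<pi>\<close> treats both projections at
  once.
\<close>

lemma covering_projection_iff:
  assumes comp: "connected_component square_quiver C"
    and proj: "\<And>a u u'. pair_arrow a u u' \<Longrightarrow> arrow a (\<pi> u) (\<pi> u')"
    and basis: "\<And>i u. (i, u) \<in> verts C \<Longrightarrow> \<pi> u \<in> basis i"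
  shows "covering_map C (coeff_quiver Q V) (\<lambda>(i, u). (i, \<pi> u))
      (\<lambda>(a, s, t). (a, (case s of (i, u) \<Rightarrow> (i, \<pi> u)), (case t of (i, u) \<Rightarrow> (i, \<pi> u)))) \<longleftrightarrow>
    (\<forall>a u x'. (tail Q a, u) \<in> verts C \<longrightarrow> arrow a (\<pi> u) x' \<longrightarrow> (\<exists>u'. pair_arrow a u u')) \<and>
    (\<forall>a u' x. (head Q a, u') \<in> verts C \<longrightarrow> arrow a x (\<pi> u') \<longrightarrow> (\<exists>u. pair_arrow a u u'))"
    (is "covering_map C _ ?p ?q \<longleftrightarrow> ?lifts")
proof -
  note C = connected_componentD[OF comp]
  have ends: "tail C = (\<lambda>(a, s, t). s)" "head C = (\<lambda>(a, s, t). t)"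
    by (simp_all add: C coeff_quiver_ends)
  have arc_form: "\<exists>a u u'. b = (a, (tail Q a, u), (head Q a, u')) \<and> pair_arrow a u u'"
    if "b \<in> arcs C" for b
    using that C(6) unfolding arcs_square_quiver by blast
  have arcs_C: "(a, (tail Q a, u), (head Q a, u')) \<in> arcs C"
    if "pair_arrow a u u'" "(tail Q a, u) \<in> verts C \<or> (head Q a, u') \<in> verts C" for a u u'
    using that
    by (intro connected_component_absorbs_arc[OF comp])
      (unfold arcs_square_quiver coeff_quiver_ends, blast, simp)
  have verts_Q: "i \<in> verts Q" if "(i, u) \<in> verts C" for i u
    using that C(5) by (auto simp: verts_square_quiver)
  have mor: "quiver_morphism C (coeff_quiver Q V) ?p ?q"
    using verts_Q basis proj
    by (auto simp: quiver_morphism_def verts_coeff_quiver arcs_coeff_quiver coeff_quiver_ends ends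
        dest!: arc_form)
  show ?thesis
  proof
    assume cov: "covering_map C (coeff_quiver Q V) ?p ?q"
    show ?lifts
    proof (intro conjI allI impI)
      fix a u x'
      assume u: "(tail Q a, u) \<in> verts C" and ax: "arrow a (\<pi> u) x'"
      let ?b = "(a, (tail Q a, \<pi> u), (head Q a, x'))"
      have "?b \<in> arcs (coeff_quiver Q V)" "(tail Q a, \<pi> u) \<in> verts (coeff_quiver Q V)"
        using ax by (auto simp: arcs_coeff_quiver verts_coeff_quiver dest: arrowD)
      moreover have "?p (tail Q a, u) = (tail Q a, \<pi> u)" "tail (coeff_quiver Q V) ?b = (tail Q a, \<pi> u)"
        by (simp_all add: coeff_quiver_ends)
      ultimately have "\<exists>!b. b \<in> arcs C \<and> ?q b = ?b \<and> tail C b = (tail Q a, u)"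
        using cov u unfolding covering_map_def by blast
      then show "\<exists>u'. pair_arrow a u u'"
        by (auto simp: ends dest!: arc_form)
    next
      fix a u' x
      assume u': "(head Q a, u') \<in> verts C" and ax: "arrow a x (\<pi> u')"
      let ?b = "(a, (tail Q a, x), (head Q a, \<pi> u'))"
      have "?b \<in> arcs (coeff_quiver Q V)" "(head Q a, \<pi> u') \<in> verts (coeff_quiver Q V)"
        using ax by (auto simp: arcs_coeff_quiver verts_coeff_quiver dest: arrowD)
      moreover have "?p (head Q a, u') = (head Q a, \<pi> u')" "head (coeff_quiver Q V) ?b = (head Q a, \<pi> u')"
        by (simp_all add: coeff_quiver_ends)
      ultimately have "\<exists>!b. b \<in> arcs C \<and> ?q b = ?b \<and> head C b = (head Q a, u')"
        using cov u' unfolding covering_map_def by blast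
      then show "\<exists>u. pair_arrow a u u'"
        by (auto simp: ends dest!: arc_form)
    qed
  next
    assume lifts: ?lifts
    show "covering_map C (coeff_quiver Q V) ?p ?q"
      unfolding covering_map_def
    proof (intro conjI ballI impI mor)
      fix v s b
      assume s: "s \<in> verts C" "?p s = v" and b: "b \<in> arcs (coeff_quiver Q V)"
        and tail_b: "tail (coeff_quiver Q V) b = v"
      obtain a x x' where b_eq: "b = (a, (tail Q a, x), (head Q a, x'))" and ax: "arrow a x x'"
        using b by (auto simp: arcs_coeff_quiver)
      obtain u where s_eq: "s = (tail Q a, u)" and x: "x = \<pi> u"
        using s tail_b by (cases s) (auto simp: b_eq coeff_quiver_ends)
      obtain u' where u': "pair_arrow a u u'"
        using lifts s(1) ax unfolding s_eq x by blast
      show "\<exists>!b'. b' \<in> arcs C \<and> ?q b' = b \<and> tail C b' = s"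
      proof (rule ex1I)
        show "(a, s, (head Q a, u')) \<in> arcs C \<and> ?q (a, s, (head Q a, u')) = b \<and>
            tail C (a, s, (head Q a, u')) = s"
          using arcs_C[OF u'] s(1) arrow_functional[OF ax, of "\<pi> u'"] proj[OF u']
          by (simp add: s_eq b_eq x ends)
      next
        fix b' assume "b' \<in> arcs C \<and> ?q b' = b \<and> tail C b' = s"
        then show "b' = (a, s, (head Q a, u'))"
          using pair_arrow_functional[OF u'] by (auto simp: s_eq b_eq ends dest!: arc_form)
      qed
    next
      fix v s b
      assume s: "s \<in> verts C" "?p s = v" and b: "b \<in> arcs (coeff_quiver Q V)"
        and head_b: "head (coeff_quiver Q V) b = v"
      obtain a x x' where b_eq: "b = (a, (tail Q a, x), (head Q a, x'))" and ax: "arrow a x x'"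
        using b by (auto simp: arcs_coeff_quiver)
      obtain u' where s_eq: "s = (head Q a, u')" and x': "x' = \<pi> u'"
        using s head_b by (cases s) (auto simp: b_eq coeff_quiver_ends)
      obtain u where u: "pair_arrow a u u'"
        using lifts s(1) ax unfolding s_eq x' by blast
      show "\<exists>!b'. b' \<in> arcs C \<and> ?q b' = b \<and> head C b' = s"
      proof (rule ex1I)
        show "(a, (tail Q a, u), s) \<in> arcs C \<and> ?q (a, (tail Q a, u), s) = b \<and>
            head C (a, (tail Q a, u), s) = s"
          using arcs_C[OF u] s(1) arrow_injective[of a "\<pi> u" x' x] ax proj[OF u]
          by (simp add: s_eq b_eq x' ends)
      next
        fix b' assume "b' \<in> arcs C \<and> ?q b' = b \<and> head C b' = s"
        then show "b' = (a, (tail Q a, u), s)"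
          using pair_arrow_injective[OF u] by (auto simp: s_eq b_eq ends dest!: arc_form)
      qed
    qed
  qed
qed

lemma covering_component_iff_lifts:
  assumes "connected_component square_quiver C"
  shows "covering_component Q V V C \<longleftrightarrow>
    (\<forall>a x y. (tail Q a, (x, y)) \<in> verts C \<longrightarrow> (\<exists>x'. arrow a x x') \<longleftrightarrow> (\<exists>y'. arrow a y y')) \<and>
    (\<forall>a x' y'. (head Q a, (x', y')) \<in> verts C \<longrightarrow> (\<exists>x. arrow a x x') \<longleftrightarrow> (\<exists>y. arrow a y y'))"
proof -
  have basis: "x \<in> basis i" "y \<in> basis i" if "(i, (x, y)) \<in> verts C" for i x y
    using that connected_componentD(5)[OF assms] by (auto simp: verts_square_quiver)
  have projections: "proj1_vert = (\<lambda>(i, u). (i, fst u))" "proj2_vert = (\<lambda>(i, u). (i, snd u))"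
    by (auto simp: proj1_vert_def proj2_vert_def)
  have "covering_map C (coeff_quiver Q V) proj1_vert proj1_arc \<longleftrightarrow>
    (\<forall>a u x'. (tail Q a, u) \<in> verts C \<longrightarrow> arrow a (fst u) x' \<longrightarrow> (\<exists>u'. pair_arrow a u u')) \<and>
    (\<forall>a u' x. (head Q a, u') \<in> verts C \<longrightarrow> arrow a x (fst u') \<longrightarrow> (\<exists>u. pair_arrow a u u'))"
    unfolding proj1_arc_def projections
    by (rule covering_projection_iff[OF assms]) (auto simp: pair_arrow_def dest: basis)
  moreover have "covering_map C (coeff_quiver Q V) proj2_vert proj2_arc \<longleftrightarrow>
    (\<forall>a u x'. (tail Q a, u) \<in> verts C \<longrightarrow> arrow a (snd u) x' \<longrightarrow> (\<exists>u'. pair_arrow a u u')) \<and>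
    (\<forall>a u' x. (head Q a, u') \<in> verts C \<longrightarrow> arrow a x (snd u') \<longrightarrow> (\<exists>u. pair_arrow a u u'))"
    unfolding proj2_arc_def projections
    by (rule covering_projection_iff[OF assms]) (auto simp: pair_arrow_def dest: basis)
  ultimately show ?thesis
    unfolding covering_component_def using assms by (simp add: pair_arrow_def) blast
qed

text \<open>
  The pairs in a covering component form a simulation, and so do the reversed pairs.
\<close>

lemma covering_component_imp_bisimilar:
  assumes "covering_component Q V V C" "(i, (x, y)) \<in> verts C"
  shows "bisimilar i x y"
proof -
  have comp: "connected_component square_quiver C"
    using assms(1) by (simp add: covering_component_def)
  note C = connected_componentD[OF comp]
  have closed: "(tail Q a, (x, y)) \<in> verts C \<longleftrightarrow> (head Q a, (x', y')) \<in> verts C"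
    if "arrow a x x'" "arrow a y y'" for a x y x' y'
  proof -
    have "(a, (tail Q a, (x, y)), (head Q a, (x', y'))) \<in> arcs square_quiver"
      using that by (auto simp: arcs_square_quiver pair_arrow_def)
    from connected_component_absorbs_arc[OF comp this] show ?thesis
      using wf_digraph.wellformed[OF C(3)] by (fastforce simp: C(7,8) coeff_quiver_ends)
  qed
  have verts: "i \<in> verts Q \<and> x \<in> basis i \<and> y \<in> basis i" if "(i, (x, y)) \<in> verts C" for i x y
    using that C(5) by (auto simp: verts_square_quiver)
  have "simulation (\<lambda>i x y. (i, (x, y)) \<in> verts C)" "simulation (\<lambda>i x y. (i, (y, x)) \<in> verts C)"
    using assms(1) verts closed unfolding simulation_def covering_component_iff_lifts[OF comp]
    by meson+
  then show ?thesis
    using assms(2) by (auto simp: bisimilar_def intro: similarI)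
qed

text \<open>
  Bisimilarity is invariant along the arrows of \<open>\<Gamma>\<^bsub>V \<otimes> V\<^esub>\<close>, so one bisimilar pair makes the
  whole component bisimilar.
\<close>

lemma bisimilar_imp_covering_component:
  assumes "connected_component square_quiver C" "(i, (x, y)) \<in> verts C" "bisimilar i x y"
  shows "covering_component Q V V C"
proof -
  have bisim: "bisimilar j z w" if "(j, (z, w)) \<in> verts C" for j z w
  proof -
    have "walk_related square_quiver (i, (x, y)) (j, (z, w))"
      using connected_component_verts[OF assms(1,2)] that by auto
    then have "(j, (z, w)) \<in> {(j, (z, w)). bisimilar j z w}"
    proof (rule walk_related_closed)
      fix b assume "b \<in> arcs square_quiver"
      then obtain a z w z' w' where b: "b = (a, (tail Q a, (z, w)), (head Q a, (z', w')))"
        and arrows: "arrow a z z'" "arrow a w w'"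
        by (auto simp: arcs_square_quiver pair_arrow_def)
      have "bisimilar (tail Q a) z w \<longleftrightarrow> bisimilar (head Q a) z' w'"
        using arrows by (metis bisimilar_forward bisimilar_backward arrow_functional arrow_injective)
      then show "tail square_quiver b \<in> {(j, (z, w)). bisimilar j z w} \<longleftrightarrow>
          head square_quiver b \<in> {(j, (z, w)). bisimilar j z w}"
        by (simp add: b coeff_quiver_ends)
    qed (use assms(3) in simp)
    then show ?thesis
      by simp
  qed
  then show ?thesis
    unfolding covering_component_iff_lifts[OF assms(1)]
    by (meson bisim bisimilar_sym bisimilar_forward bisimilar_backward)
qed

text \<open>
  By connectedness of \<open>\<Gamma>\<^bsub>V\<^esub>\<close> the diagonal lies in a single component. It is covering, and no
  arrow joins the diagonal to a pair of distinct elements. Hence further covering components are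
  the same thing as pairs of distinct bisimilar elements.
\<close>

theorem rigid_iff_unique_covering_component:
  assumes "f1_indecomposable Q V"
  shows "rigid \<longleftrightarrow> (\<exists>!C. covering_component Q V V C)"
proof -
  obtain i\<^sub>0 x\<^sub>0 where x0: "i\<^sub>0 \<in> verts Q" "x\<^sub>0 \<in> basis i\<^sub>0"
    using assms by (auto simp: f1_indecomposable_def f1_nonzero_def)
  obtain D where D: "connected_component square_quiver D" "(i\<^sub>0, (x\<^sub>0, x\<^sub>0)) \<in> verts D"
    using connected_component_exists[OF wf_square_quiver, of "(i\<^sub>0, (x\<^sub>0, x\<^sub>0))"] x0
    by (auto simp: verts_square_quiver)
  have cov_D: "covering_component Q V V D"
    using bisimilar_imp_covering_component[OF D] bisimilar_refl[OF x0] by blast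
  note D_props = connected_componentD[OF D(1)]
  have diagonal: "(i, (x, x)) \<in> verts D" if "i \<in> verts Q" "x \<in> basis i" for i x
  proof -
    have "{x \<in> basis i. (i, (x, x)) \<in> verts D} = basis i"
    proof (rule indecomposable_imp_connected[OF assms, of "\<lambda>i. {x \<in> basis i. (i, (x, x)) \<in> verts D}" i\<^sub>0])
      fix a x y assume axy: "arrow a x y"
      then have "(a, (tail Q a, (x, x)), (head Q a, (y, y))) \<in> arcs square_quiver"
        by (auto simp: arcs_square_quiver pair_arrow_def)
      from connected_component_absorbs_arc[OF D(1) this]
      have "(tail Q a, (x, x)) \<in> verts D \<longleftrightarrow> (head Q a, (y, y)) \<in> verts D"
        using wf_digraph.wellformed[OF D_props(3)] by (fastforce simp: D_props(7,8) coeff_quiver_ends)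
      then show "x \<in> {x \<in> basis (tail Q a). (tail Q a, (x, x)) \<in> verts D} \<longleftrightarrow>
          y \<in> {x \<in> basis (head Q a). (head Q a, (x, x)) \<in> verts D}"
        using axy by (auto dest: arrowD)
    qed (use x0 D(2) that in auto)
    with that show ?thesis
      by blast
  qed
  show ?thesis
  proof
    assume rigid
    have "C = D" if "covering_component Q V V C" for C
    proof -
      have comp: "connected_component square_quiver C"
        using that by (simp add: covering_component_def)
      obtain i x y where C: "(i, (x, y)) \<in> verts C"
        using connected_componentD(9)[OF comp] by auto
      have bisim: "bisimilar i x y"
        using that C by (rule covering_component_imp_bisimilar)
      then have "x = y"
        using \<open>rigid\<close> by (auto simp: rigid_def)
      with bisim C diagonal have "(i, (x, x)) \<in> verts C" "(i, (x, x)) \<in> verts D"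
        by (auto dest: bisimilarD)
      with comp D(1) show ?thesis
        by (intro connected_component_unique)
    qed
    with cov_D show "\<exists>!C. covering_component Q V V C"
      by blast
  next
    assume unique: "\<exists>!C. covering_component Q V V C"
    show rigid
      unfolding rigid_def
    proof (intro allI impI)
      fix i x y assume bisim: "bisimilar i x y"
      obtain C where C: "connected_component square_quiver C" "(i, (x, y)) \<in> verts C"
        using connected_component_exists[OF wf_square_quiver, of "(i, (x, y))"] bisimilarD[OF bisim]
        by (auto simp: verts_square_quiver)
      then have "C = D"
        using unique cov_D bisimilar_imp_covering_component[OF C bisim] by blast
      have "walk_related square_quiver (i\<^sub>0, (x\<^sub>0, x\<^sub>0)) (i, (x, y))"
        using connected_component_verts[OF D] C(2) \<open>C = D\<close> by auto
      then have "(i, (x, y)) \<in> {(j, (z, w)). z = w}"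
      proof (rule walk_related_closed)
        fix b assume "b \<in> arcs square_quiver"
        then show "tail square_quiver b \<in> {(j, (z, w)). z = w} \<longleftrightarrow>
            head square_quiver b \<in> {(j, (z, w)). z = w}"
          by (auto simp: arcs_square_quiver coeff_quiver_ends pair_arrow_def
              intro: arrow_functional arrow_injective)
      qed simp
      then show "x = y"
        by simp
    qed
  qed
qed

end

section \<open>Endomorphisms and decompositions over a field\<close>

definition k_endomorphism :: "'k ring \<Rightarrow> ('v, 'e) pre_digraph \<Rightarrow> ('v, 'e, 'k, 'm) k_rep \<Rightarrow>
    ('v \<Rightarrow> 'm \<Rightarrow> 'm) \<Rightarrow> bool" where
  "k_endomorphism K Q M e \<longleftrightarrow>
     (\<forall>i\<in>verts Q. linear_map K (k_obj M i) (k_obj M i) (e i)) \<and>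
     (\<forall>a\<in>arcs Q. \<forall>x\<in>carrier (k_obj M (tail Q a)).
        e (head Q a) (k_map M a x) = k_map M a (e (tail Q a) x))"

lemma linear_mapI:
  assumes "vectorspace K A" "vectorspace K B"
    and "\<And>x. x \<in> carrier A \<Longrightarrow> f x \<in> carrier B"
    and "\<And>x y. x \<in> carrier A \<Longrightarrow> y \<in> carrier A \<Longrightarrow> f (x \<oplus>\<^bsub>A\<^esub> y) = f x \<oplus>\<^bsub>B\<^esub> f y"
    and "\<And>c x. c \<in> carrier K \<Longrightarrow> x \<in> carrier A \<Longrightarrow> f (c \<odot>\<^bsub>A\<^esub> x) = c \<odot>\<^bsub>B\<^esub> f x"
  shows "linear_map K A B f"
  using assms
  by (auto simp: linear_map_def mod_hom_def mod_hom_axioms_def module_hom_def vectorspace_def)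

lemma linear_mapD:
  assumes "linear_map K A B f"
  shows "vectorspace K A" "vectorspace K B"
    and "\<And>x. x \<in> carrier A \<Longrightarrow> f x \<in> carrier B"
    and "\<And>x y. x \<in> carrier A \<Longrightarrow> y \<in> carrier A \<Longrightarrow> f (x \<oplus>\<^bsub>A\<^esub> y) = f x \<oplus>\<^bsub>B\<^esub> f y"
    and "\<And>c x. c \<in> carrier K \<Longrightarrow> x \<in> carrier A \<Longrightarrow> f (c \<odot>\<^bsub>A\<^esub> x) = c \<odot>\<^bsub>B\<^esub> f x"
    and "f \<zero>\<^bsub>A\<^esub> = \<zero>\<^bsub>B\<^esub>"
proof -
  interpret linear_map K A B f by fact
  show "vectorspace K A" "vectorspace K B"
    by unfold_locales
  show "f x \<in> carrier B" if "x \<in> carrier A" for x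
    using that by simp
  show "f (x \<oplus>\<^bsub>A\<^esub> y) = f x \<oplus>\<^bsub>B\<^esub> f y" if "x \<in> carrier A" "y \<in> carrier A" for x y
    using that by simp
  show "f (c \<odot>\<^bsub>A\<^esub> x) = c \<odot>\<^bsub>B\<^esub> f x" if "c \<in> carrier K" "x \<in> carrier A" for c x
    using that by simp
  show "f \<zero>\<^bsub>A\<^esub> = \<zero>\<^bsub>B\<^esub>"
    by simp
qed

lemma linear_map_diff:
  assumes "linear_map K A B f" "x \<in> carrier A" "y \<in> carrier A"
  shows "f (x \<ominus>\<^bsub>A\<^esub> y) = f x \<ominus>\<^bsub>B\<^esub> f y"
proof -
  interpret linear_map K A B f by fact
  show ?thesis
    using assms(2,3) by simp
qed

lemma (in abelian_group) diff_of_sums: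
  "x \<in> carrier G \<Longrightarrow> y \<in> carrier G \<Longrightarrow> u \<in> carrier G \<Longrightarrow> v \<in> carrier G \<Longrightarrow>
    (x \<oplus> y) \<ominus> (u \<oplus> v) = (x \<ominus> u) \<oplus> (y \<ominus> v)"
  by (simp add: a_minus_def minus_add a_ac)

lemma (in abelian_group) add_diff_cancel:
  "x \<in> carrier G \<Longrightarrow> y \<in> carrier G \<Longrightarrow> y \<oplus> (x \<ominus> y) = x"
  by (simp add: a_minus_def a_lcomm r_neg)

lemma (in abelian_group) sum_diff_cancel:
  "x \<in> carrier G \<Longrightarrow> y \<in> carrier G \<Longrightarrow> (x \<oplus> y) \<ominus> x = y"
  by (simp add: a_minus_def a_comm[of x y] a_assoc r_neg)

definition restrict_rep :: "('v, 'e, 'k, 'm) k_rep \<Rightarrow> ('v \<Rightarrow> 'm set) \<Rightarrow> ('v, 'e, 'k, 'm) k_rep" where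
  "restrict_rep M U = \<lparr>k_obj = (\<lambda>i. (k_obj M i)\<lparr>carrier := U i\<rparr>), k_map = k_map M\<rparr>"

lemma restrict_rep_is_rep:
  assumes "wf_digraph Q" "k_rep K Q M"
    and sub: "\<And>i. i \<in> verts Q \<Longrightarrow> submodule K (U i) (k_obj M i)"
    and inv: "\<And>a x. a \<in> arcs Q \<Longrightarrow> x \<in> U (tail Q a) \<Longrightarrow> k_map M a x \<in> U (head Q a)"
  shows "k_rep K Q (restrict_rep M U)"
proof -
  interpret wf_digraph Q by fact
  have vs: "vectorspace K (k_obj (restrict_rep M U) i)" if "i \<in> verts Q" for i
  proof -
    interpret vectorspace K "k_obj M i"
      using assms(2) that by (simp add: k_rep_def)
    show ?thesis
      using subspace_is_vs sub[OF that] vectorspace_axioms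
      by (simp add: restrict_rep_def VectorSpace.subspace_def)
  qed
  moreover have "linear_map K (k_obj (restrict_rep M U) (tail Q a))
      (k_obj (restrict_rep M U) (head Q a)) (k_map (restrict_rep M U) a)" if a: "a \<in> arcs Q" for a
  proof (rule linear_mapI)
    have f: "linear_map K (k_obj M (tail Q a)) (k_obj M (head Q a)) (k_map M a)"
      using assms(2) a by (simp add: k_rep_def)
    have U: "x \<in> carrier (k_obj M (tail Q a))" if "x \<in> U (tail Q a)" for x
      using submodule.subset[OF sub[OF tail_in_verts[OF a]]] that by auto
    show "k_map (restrict_rep M U) a x \<in> carrier (k_obj (restrict_rep M U) (head Q a))"
      if "x \<in> carrier (k_obj (restrict_rep M U) (tail Q a))" for x
      using inv[OF a] that by (simp add: restrict_rep_def)
    show "k_map (restrict_rep M U) a (x \<oplus>\<^bsub>k_obj (restrict_rep M U) (tail Q a)\<^esub> y)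
        = k_map (restrict_rep M U) a x \<oplus>\<^bsub>k_obj (restrict_rep M U) (head Q a)\<^esub> k_map (restrict_rep M U) a y"
      if "x \<in> carrier (k_obj (restrict_rep M U) (tail Q a))"
        "y \<in> carrier (k_obj (restrict_rep M U) (tail Q a))" for x y
      using that linear_mapD(4)[OF f] U by (simp add: restrict_rep_def)
    show "k_map (restrict_rep M U) a (c \<odot>\<^bsub>k_obj (restrict_rep M U) (tail Q a)\<^esub> x)
        = c \<odot>\<^bsub>k_obj (restrict_rep M U) (head Q a)\<^esub> k_map (restrict_rep M U) a x"
      if "c \<in> carrier K" "x \<in> carrier (k_obj (restrict_rep M U) (tail Q a))" for c x
      using that linear_mapD(5)[OF f] U by (simp add: restrict_rep_def)
  qed (use vs a in auto)
  ultimately show ?thesis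
    by (simp add: k_rep_def)
qed

text \<open>
  An idempotent \<open>e\<close> splits \<open>M\<close> into its image \<open>U\<close> and its kernel \<open>W\<close>. One vector suffices to witness that
  both are nonzero, as \<open>e x\<close> lies in the image and \<open>x - e x\<close> in the kernel.
\<close>

lemma idempotent_endomorphism_imp_decomposable:
  assumes wf: "wf_digraph Q" and M: "k_rep K Q M" and e: "k_endomorphism K Q M e"
    and idem: "\<And>i x. i \<in> verts Q \<Longrightarrow> x \<in> carrier (k_obj M i) \<Longrightarrow> e i (e i x) = e i x"
    and witness: "i\<^sub>0 \<in> verts Q" "x\<^sub>0 \<in> carrier (k_obj M i\<^sub>0)"
      "e i\<^sub>0 x\<^sub>0 \<noteq> \<zero>\<^bsub>k_obj M i\<^sub>0\<^esub>" "e i\<^sub>0 x\<^sub>0 \<noteq> x\<^sub>0"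
  shows "\<not> k_indecomposable K Q M"
proof -
  interpret wf_digraph Q by fact
  define U W where "U i = {x \<in> carrier (k_obj M i). e i x = x}"
    and "W i = {x \<in> carrier (k_obj M i). e i x = \<zero>\<^bsub>k_obj M i\<^esub>}" for i
  let ?X = "restrict_rep M U" and ?Y = "restrict_rep M W"
  have vs: "vectorspace K (k_obj M i)" if "i \<in> verts Q" for i
    using M that by (simp add: k_rep_def)
  have lin: "linear_map K (k_obj M i) (k_obj M i) (e i)" if "i \<in> verts Q" for i
    using e that by (simp add: k_endomorphism_def)
  have arc_lin: "linear_map K (k_obj M (tail Q a)) (k_obj M (head Q a)) (k_map M a)"
    if "a \<in> arcs Q" for a
    using M that by (simp add: k_rep_def)
  have commute: "e (head Q a) (k_map M a x) = k_map M a (e (tail Q a) x)"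
    if "a \<in> arcs Q" "x \<in> carrier (k_obj M (tail Q a))" for a x
    using e that by (simp add: k_endomorphism_def)
  have sub_U: "submodule K (U i) (k_obj M i)" and sub_W: "submodule K (W i) (k_obj M i)"
    if "i \<in> verts Q" for i
  proof -
    interpret linear_map K "k_obj M i" "k_obj M i" "e i"
      by (rule lin[OF that])
    show "submodule K (U i) (k_obj M i)"
      by unfold_locales (auto simp: U_def)
    show "submodule K (W i) (k_obj M i)"
      by unfold_locales (auto simp: W_def)
  qed
  have X: "k_rep K Q ?X"
    using wf M sub_U
  proof (rule restrict_rep_is_rep)
    show "k_map M a x \<in> U (head Q a)" if "a \<in> arcs Q" "x \<in> U (tail Q a)" for a x
      using that commute[OF that(1)] linear_mapD(3)[OF arc_lin[OF that(1)]] by (simp add: U_def)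
  qed
  have Y: "k_rep K Q ?Y"
    using wf M sub_W
  proof (rule restrict_rep_is_rep)
    show "k_map M a x \<in> W (head Q a)" if "a \<in> arcs Q" "x \<in> W (tail Q a)" for a x
      using that commute[OF that(1)] linear_mapD(3,6)[OF arc_lin[OF that(1)]] by (simp add: W_def)
  qed
  define \<phi> where "\<phi> i x = (e i x, x \<ominus>\<^bsub>k_obj M i\<^esub> e i x)" for i x
  have obj: "k_obj (k_sum ?X ?Y) i
      = direct_sum ((k_obj M i)\<lparr>carrier := U i\<rparr>) ((k_obj M i)\<lparr>carrier := W i\<rparr>)" for i
    by (simp add: k_sum_def restrict_rep_def)
  have split: "e i x \<in> U i \<and> x \<ominus>\<^bsub>k_obj M i\<^esub> e i x \<in> W i"
    if "i \<in> verts Q" "x \<in> carrier (k_obj M i)" for i x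
  proof -
    interpret linear_map K "k_obj M i" "k_obj M i" "e i"
      by (rule lin[OF that(1)])
    show ?thesis
      using that idem by (simp add: U_def W_def)
  qed
  have "linear_map K (k_obj M i) (k_obj (k_sum ?X ?Y) i) (\<phi> i)" if i: "i \<in> verts Q" for i
  proof (rule linear_mapI)
    interpret linear_map K "k_obj M i" "k_obj M i" "e i"
      by (rule lin[OF i])
    have ab: "abelian_group (k_obj M i)"
      by unfold_locales
    show "vectorspace K (k_obj (k_sum ?X ?Y) i)"
      using X Y i unfolding k_rep_def by (auto simp: k_sum_def intro: direct_sum_is_vs)
    show "\<phi> i x \<in> carrier (k_obj (k_sum ?X ?Y) i)" if "x \<in> carrier (k_obj M i)" for x
      using split[OF i that] by (simp add: obj direct_sum_def \<phi>_def)
    show "\<phi> i (x \<oplus>\<^bsub>k_obj M i\<^esub> y) = \<phi> i x \<oplus>\<^bsub>k_obj (k_sum ?X ?Y) i\<^esub> \<phi> i y"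
      if "x \<in> carrier (k_obj M i)" "y \<in> carrier (k_obj M i)" for x y
      using that by (simp add: obj direct_sum_def \<phi>_def abelian_group.diff_of_sums[OF ab])
    show "\<phi> i (c \<odot>\<^bsub>k_obj M i\<^esub> x) = c \<odot>\<^bsub>k_obj (k_sum ?X ?Y) i\<^esub> \<phi> i x"
      if "c \<in> carrier K" "x \<in> carrier (k_obj M i)" for c x
      using that smult_r_distr smult_r_minus
      by (simp add: obj direct_sum_def \<phi>_def a_minus_def)
  qed (rule vs[OF i])
  moreover have "bij_betw (\<phi> i) (carrier (k_obj M i)) (carrier (k_obj (k_sum ?X ?Y) i))"
    if i: "i \<in> verts Q" for i
  proof (rule bij_betw_byWitness[where f' = "\<lambda>(x, y). x \<oplus>\<^bsub>k_obj M i\<^esub> y"])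
    interpret linear_map K "k_obj M i" "k_obj M i" "e i"
      by (rule lin[OF i])
    have ab: "abelian_group (k_obj M i)"
      by unfold_locales
    show "\<forall>x\<in>carrier (k_obj M i). (\<lambda>(x, y). x \<oplus>\<^bsub>k_obj M i\<^esub> y) (\<phi> i x) = x"
      by (auto simp: \<phi>_def abelian_group.add_diff_cancel[OF ab])
    show "\<forall>z\<in>carrier (k_obj (k_sum ?X ?Y) i). \<phi> i ((\<lambda>(x, y). x \<oplus>\<^bsub>k_obj M i\<^esub> y) z) = z"
      by (auto simp: \<phi>_def obj direct_sum_def U_def W_def abelian_group.sum_diff_cancel[OF ab])
    show "\<phi> i ` carrier (k_obj M i) \<subseteq> carrier (k_obj (k_sum ?X ?Y) i)"
      using split[OF i] by (auto simp: obj direct_sum_def \<phi>_def)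
    show "(\<lambda>(x, y). x \<oplus>\<^bsub>k_obj M i\<^esub> y) ` carrier (k_obj (k_sum ?X ?Y) i) \<subseteq> carrier (k_obj M i)"
      by (auto simp: obj direct_sum_def U_def W_def)
  qed
  moreover have "\<phi> (head Q a) (k_map M a x) = k_map (k_sum ?X ?Y) a (\<phi> (tail Q a) x)"
    if "a \<in> arcs Q" "x \<in> carrier (k_obj M (tail Q a))" for a x
    using that commute linear_map_diff[OF arc_lin] linear_mapD(3)[OF lin]
    by (simp add: \<phi>_def k_sum_def restrict_rep_def)
  ultimately have "k_iso K Q M (k_sum ?X ?Y)"
    unfolding k_iso_def by blast
  moreover have "k_nonzero Q ?X" "k_nonzero Q ?Y"
  proof -
    interpret linear_map K "k_obj M i\<^sub>0" "k_obj M i\<^sub>0" "e i\<^sub>0"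
      by (rule lin[OF witness(1)])
    have "x\<^sub>0 \<ominus>\<^bsub>k_obj M i\<^sub>0\<^esub> e i\<^sub>0 x\<^sub>0 \<noteq> \<zero>\<^bsub>k_obj M i\<^sub>0\<^esub>"
      using witness by auto
    with witness(3) have "U i\<^sub>0 \<noteq> {\<zero>\<^bsub>k_obj M i\<^sub>0\<^esub>}" "W i\<^sub>0 \<noteq> {\<zero>\<^bsub>k_obj M i\<^sub>0\<^esub>}"
      using split[OF witness(1,2)] by blast+
    then show "k_nonzero Q ?X" "k_nonzero Q ?Y"
      using witness(1) by (auto simp: k_nonzero_def restrict_rep_def)
  qed
  ultimately show ?thesis
    using X Y unfolding k_indecomposable_def by blast
qed

text \<open>
  The projection to the first summand, transported along the isomorphism. As both summands are
  nonzero, it has eigenvectors for the eigenvalues \<open>1\<close> and \<open>0\<close>.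
\<close>

lemma decomposable_imp_splitting_endomorphism:
  fixes M :: "('v, 'e, 'k, 'm) k_rep"
  assumes M: "k_rep K Q M" and "wf_digraph Q" "k_nonzero Q M" "\<not> k_indecomposable K Q M"
  obtains e i x j y where "k_endomorphism K Q M e"
    "i \<in> verts Q" "x \<in> carrier (k_obj M i)" "x \<noteq> \<zero>\<^bsub>k_obj M i\<^esub>" "e i x = x"
    "j \<in> verts Q" "y \<in> carrier (k_obj M j)" "y \<noteq> \<zero>\<^bsub>k_obj M j\<^esub>" "e j y = \<zero>\<^bsub>k_obj M j\<^esub>"
proof -
  interpret wf_digraph Q by fact
  obtain X Y :: "('v, 'e, 'k, 'm) k_rep" where X: "k_rep K Q X" "k_nonzero Q X" and Y: "k_rep K Q Y" "k_nonzero Q Y"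
    and iso: "k_iso K Q M (k_sum X Y)"
    using assms(3,4) unfolding k_indecomposable_def by blast
  from iso obtain \<phi> where
    lin: "\<And>i. i \<in> verts Q \<Longrightarrow> linear_map K (k_obj M i) (k_obj (k_sum X Y) i) (\<phi> i)"
    and bij: "\<And>i. i \<in> verts Q \<Longrightarrow> bij_betw (\<phi> i) (carrier (k_obj M i)) (carrier (k_obj (k_sum X Y) i))"
    and commute: "\<And>a x. a \<in> arcs Q \<Longrightarrow> x \<in> carrier (k_obj M (tail Q a)) \<Longrightarrow>
        \<phi> (head Q a) (k_map M a x) = k_map (k_sum X Y) a (\<phi> (tail Q a) x)"
    unfolding k_iso_def by blast
  define \<psi> where "\<psi> i = inv_into (carrier (k_obj M i)) (\<phi> i)" for i
  have obj: "k_obj (k_sum X Y) i = direct_sum (k_obj X i) (k_obj Y i)" for i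
    by (simp add: k_sum_def)
  have map: "k_map (k_sum X Y) a = map_prod (k_map X a) (k_map Y a)" for a
    by (simp add: k_sum_def)
  have carrier_sum: "carrier (k_obj (k_sum X Y) i) = carrier (k_obj X i) \<times> carrier (k_obj Y i)" for i
    by (simp add: obj direct_sum_def)
  have \<psi>: "\<psi> i z \<in> carrier (k_obj M i)" "\<phi> i (\<psi> i z) = z"
    if "i \<in> verts Q" "z \<in> carrier (k_obj X i) \<times> carrier (k_obj Y i)" for i z
    using that bij_betw_inv_into_right[OF bij] bij_betw_apply[OF bij_betw_inv_into[OF bij]]
    by (simp_all add: \<psi>_def carrier_sum)
  have inj: "x = y" if "i \<in> verts Q" "x \<in> carrier (k_obj M i)" "y \<in> carrier (k_obj M i)" "\<phi> i x = \<phi> i y"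
    for i x y
    using bij[OF that(1)] that by (auto simp: bij_betw_def inj_on_def)
  have \<phi>_carrier: "\<phi> i x \<in> carrier (k_obj X i) \<times> carrier (k_obj Y i)"
    if "i \<in> verts Q" "x \<in> carrier (k_obj M i)" for i x
    using linear_mapD(3)[OF lin] that by (simp add: carrier_sum)
  define e where "e i x = \<psi> i (fst (\<phi> i x), \<zero>\<^bsub>k_obj Y i\<^esub>)" for i x
  have zeros: "\<zero>\<^bsub>k_obj X i\<^esub> \<in> carrier (k_obj X i)" "\<zero>\<^bsub>k_obj Y i\<^esub> \<in> carrier (k_obj Y i)"
    if "i \<in> verts Q" for i
  proof -
    interpret X: vectorspace K "k_obj X i" using X that by (simp add: k_rep_def)
    interpret Y: vectorspace K "k_obj Y i" using Y that by (simp add: k_rep_def)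
    show "\<zero>\<^bsub>k_obj X i\<^esub> \<in> carrier (k_obj X i)" "\<zero>\<^bsub>k_obj Y i\<^esub> \<in> carrier (k_obj Y i)"
      by simp_all
  qed
  have e: "e i x \<in> carrier (k_obj M i)" "\<phi> i (e i x) = (fst (\<phi> i x), \<zero>\<^bsub>k_obj Y i\<^esub>)"
    if "i \<in> verts Q" "x \<in> carrier (k_obj M i)" for i x
    using \<psi>[OF that(1), of "(fst (\<phi> i x), \<zero>\<^bsub>k_obj Y i\<^esub>)"] \<phi>_carrier[OF that] zeros[OF that(1)]
    by (auto simp: e_def mem_Times_iff)
  have "k_endomorphism K Q M e"
    unfolding k_endomorphism_def
  proof (intro conjI ballI)
    fix i assume i: "i \<in> verts Q"
    interpret M: vectorspace K "k_obj M i" using M i by (simp add: k_rep_def)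
    interpret Y: vectorspace K "k_obj Y i" using Y i by (simp add: k_rep_def)
    show "linear_map K (k_obj M i) (k_obj M i) (e i)"
    proof (rule linear_mapI)
      show "e i (x \<oplus>\<^bsub>k_obj M i\<^esub> y) = e i x \<oplus>\<^bsub>k_obj M i\<^esub> e i y"
        if "x \<in> carrier (k_obj M i)" "y \<in> carrier (k_obj M i)" for x y
        using that i e linear_mapD(4)[OF lin[OF i]]
        by (intro inj[OF i]) (simp_all add: obj direct_sum_def)
      show "e i (c \<odot>\<^bsub>k_obj M i\<^esub> x) = c \<odot>\<^bsub>k_obj M i\<^esub> e i x"
        if "c \<in> carrier K" "x \<in> carrier (k_obj M i)" for c x
        using that i e linear_mapD(5)[OF lin[OF i]]
        by (intro inj[OF i]) (simp_all add: obj direct_sum_def)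
    qed (use i e M.vectorspace_axioms in auto)
  next
    fix a x assume a: "a \<in> arcs Q" and x: "x \<in> carrier (k_obj M (tail Q a))"
    have M_a: "linear_map K (k_obj M (tail Q a)) (k_obj M (head Q a)) (k_map M a)"
      and Y_a: "linear_map K (k_obj Y (tail Q a)) (k_obj Y (head Q a)) (k_map Y a)"
      using M Y a by (simp_all add: k_rep_def)
    have "\<phi> (head Q a) (e (head Q a) (k_map M a x)) = \<phi> (head Q a) (k_map M a (e (tail Q a) x))"
      using a x e commute linear_mapD(3)[OF M_a] linear_mapD(6)[OF Y_a]
      by (simp add: map)
    then show "e (head Q a) (k_map M a x) = k_map M a (e (tail Q a) x)"
      using a x e linear_mapD(3)[OF M_a] by (intro inj[of "head Q a"]) auto
  qed
  moreover obtain i x where i: "i \<in> verts Q" and x: "x \<in> carrier (k_obj X i)" "x \<noteq> \<zero>\<^bsub>k_obj X i\<^esub>"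
    using X zeros unfolding k_nonzero_def by blast
  moreover obtain j y where j: "j \<in> verts Q" and y: "y \<in> carrier (k_obj Y j)" "y \<noteq> \<zero>\<^bsub>k_obj Y j\<^esub>"
    using Y zeros unfolding k_nonzero_def by blast
  moreover have \<phi>_zero: "\<phi> l \<zero>\<^bsub>k_obj M l\<^esub> = (\<zero>\<^bsub>k_obj X l\<^esub>, \<zero>\<^bsub>k_obj Y l\<^esub>)" if "l \<in> verts Q" for l
    using linear_mapD(6)[OF lin[OF that]] by (simp add: obj direct_sum_def)
  have M_zero: "\<zero>\<^bsub>k_obj M l\<^esub> \<in> carrier (k_obj M l)" if "l \<in> verts Q" for l
  proof -
    interpret M: vectorspace K "k_obj M l" using M that by (simp add: k_rep_def)
    show ?thesis by simp
  qed
  define x' y' where "x' = \<psi> i (x, \<zero>\<^bsub>k_obj Y i\<^esub>)" and "y' = \<psi> j (\<zero>\<^bsub>k_obj X j\<^esub>, y)"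
  have x': "x' \<in> carrier (k_obj M i)" "\<phi> i x' = (x, \<zero>\<^bsub>k_obj Y i\<^esub>)"
    using \<psi>[OF i] x zeros[OF i] by (auto simp: x'_def)
  have y': "y' \<in> carrier (k_obj M j)" "\<phi> j y' = (\<zero>\<^bsub>k_obj X j\<^esub>, y)"
    using \<psi>[OF j] y zeros[OF j] by (auto simp: y'_def)
  have "x' \<noteq> \<zero>\<^bsub>k_obj M i\<^esub>" "y' \<noteq> \<zero>\<^bsub>k_obj M j\<^esub>"
    using x'(2) y'(2) x(2) y(2) \<phi>_zero[OF i] \<phi>_zero[OF j] by auto
  moreover have "e i x' = x'"
    using e[OF i x'(1)] x' by (intro inj[OF i]) auto
  moreover have "e j y' = \<zero>\<^bsub>k_obj M j\<^esub>"
    using e[OF j y'(1)] y' \<phi>_zero[OF j] M_zero[OF j] by (intro inj[OF j]) auto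
  ultimately show ?thesis
    using that x'(1) y'(1) by blast
qed

section \<open>The scalar extension\<close>

definition (in ring) basis_vector :: "'z set \<Rightarrow> 'z \<Rightarrow> 'z \<Rightarrow> 'a" where
  "basis_vector S x = (\<lambda>z\<in>S. if z = x then \<one> else \<zero>)"

lemma (in ring) basis_vector_closed: "basis_vector S x \<in> carrier (func_space S)"
  by (auto simp: basis_vector_def func_space_def)

lemma (in field) func_space_vectorspace: "vectorspace R (func_space S)"
  using func_space_is_module[of S] field_axioms by (simp add: vectorspace_def)

text \<open>
  The matrix description of a linear map. The induction enlarges the set that contains the support of
  \<open>f\<close>, splitting off one coordinate at a time.
\<close>

lemma (in field) linear_map_expansion:
  assumes e: "linear_map R (func_space S) (func_space T) e"
    and "finite S" "f \<in> carrier (func_space S)" "w \<in> T"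
  shows "e f w = (\<Oplus>x\<in>S. f x \<otimes> e (basis_vector S x) w)"
proof -
  have e_closed: "e g w \<in> carrier R" if "g \<in> carrier (func_space S)" for g
    using linear_mapD(3)[OF e that] \<open>w \<in> T\<close> by (auto simp: func_space_def)
  have "e f w = (\<Oplus>x\<in>U. f x \<otimes> e (basis_vector S x) w)"
    if "finite U" "U \<subseteq> S" "f \<in> carrier (func_space S)" "\<And>x. x \<in> S - U \<Longrightarrow> f x = \<zero>" for U f
    using that
  proof (induction U arbitrary: f)
    case empty
    then have "f = \<zero>\<^bsub>func_space S\<^esub>"
      by (auto simp: func_space_def fun_eq_iff PiE_def extensional_def)
    then have "e f w = \<zero>\<^bsub>func_space T\<^esub> w"
      using linear_mapD(6)[OF e] by simp
    then show ?case
      using \<open>w \<in> T\<close> by (simp add: func_space_def)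
  next
    case (insert u U)
    have f: "f x \<in> carrier R" if "x \<in> S" for x
      using insert.prems(2) that by (auto simp: func_space_def)
    define g where "g = (\<lambda>z\<in>S. if z = u then \<zero> else f z)"
    have g: "g \<in> carrier (func_space S)"
      using f by (auto simp: g_def func_space_def)
    have "e g w = (\<Oplus>x\<in>U. g x \<otimes> e (basis_vector S x) w)"
    proof (rule insert.IH)
      show "g x = \<zero>" if "x \<in> S - U" for x
        using that insert.prems(3)[of x] by (auto simp: g_def)
    qed (use insert.prems g in auto)
    also have "\<dots> = (\<Oplus>x\<in>U. f x \<otimes> e (basis_vector S x) w)"
      using insert.hyps insert.prems(1) f e_closed[OF basis_vector_closed]
      by (intro finsum_cong') (auto simp: g_def)
    finally have IH: "e g w = (\<Oplus>x\<in>U. f x \<otimes> e (basis_vector S x) w)" .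
    have "f = (f u \<odot>\<^bsub>func_space S\<^esub> basis_vector S u) \<oplus>\<^bsub>func_space S\<^esub> g"
    proof
      fix z
      show "f z = ((f u \<odot>\<^bsub>func_space S\<^esub> basis_vector S u) \<oplus>\<^bsub>func_space S\<^esub> g) z"
        using insert.prems f
        by (cases "z \<in> S") (auto simp: func_space_def basis_vector_def g_def PiE_def extensional_def)
    qed
    moreover have smult: "f u \<odot>\<^bsub>func_space S\<^esub> basis_vector S u \<in> carrier (func_space S)"
      using f insert.prems(1) by (auto simp: func_space_def basis_vector_def)
    ultimately have "e f = (f u \<odot>\<^bsub>func_space T\<^esub> e (basis_vector S u)) \<oplus>\<^bsub>func_space T\<^esub> e g"
      using linear_mapD(4)[OF e smult g] linear_mapD(5)[OF e _ basis_vector_closed] f insert.prems(1)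
      by auto
    then have "e f w = f u \<otimes> e (basis_vector S u) w \<oplus> e g w"
      using \<open>w \<in> T\<close> by (simp add: func_space_def)
    also have "\<dots> = (\<Oplus>x\<in>insert u U. f x \<otimes> e (basis_vector S x) w)"
      unfolding IH using insert.hyps insert.prems(1) f e_closed[OF basis_vector_closed]
      by (subst finsum_insert) auto
    finally show ?case .
  qed
  from this[of S f] assms show ?thesis
    by auto
qed

locale f1_scalar_extension = f1_quiver_rep Q V + field K
  for Q :: "('v, 'e) pre_digraph" and V :: "('v, 'e, 'x) f1_rep" and K :: "'k ring" (structure)
begin

abbreviation ext_rep :: "('v, 'e, 'k, 'x \<Rightarrow> 'k) k_rep" where
  "ext_rep \<equiv> scalar_ext K Q V"

abbreviation unit_vector :: "'v \<Rightarrow> 'x \<Rightarrow> 'x \<Rightarrow> 'k" where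
  "unit_vector i \<equiv> basis_vector (basis i)"

lemma ext_obj [simp]: "k_obj ext_rep i = func_space (basis i)"
  by (simp add: scalar_ext_def)

lemma func_space_simps:
  "f \<in> carrier (func_space S) \<longleftrightarrow> f \<in> S \<rightarrow>\<^sub>E carrier K"
  "\<zero>\<^bsub>func_space S\<^esub> = (\<lambda>x\<in>S. \<zero>)"
  "f \<oplus>\<^bsub>func_space S\<^esub> g = (\<lambda>x\<in>S. f x \<oplus> g x)"
  "c \<odot>\<^bsub>func_space S\<^esub> f = (\<lambda>x\<in>S. c \<otimes> f x)"
  by (simp_all add: func_space_def)

lemma vector_closed: "f \<in> carrier (func_space S) \<Longrightarrow> x \<in> S \<Longrightarrow> f x \<in> carrier K"
  by (auto simp: func_space_simps)

text \<open>
  As an arrow map is injective away from the base point, the sum in its linear extension has at most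
  one term: coordinates are moved along arrows or replaced by zero.
\<close>

lemma ext_map_arrow:
  assumes "arrow a x y" "f \<in> carrier (func_space (basis (tail Q a)))"
  shows "k_map ext_rep a f y = f x"
proof -
  have "{z \<in> basis (tail Q a). f1_map V a z = y} = {x}"
    using assms(1) arrow_injective by (auto simp: arrow_def)
  moreover have "f x \<in> carrier K"
    using vector_closed[OF assms(2) arrowD(2)[OF assms(1)]] .
  ultimately show ?thesis
    using arrowD(3)[OF assms(1)] finsum_insert[of "{}" x f] by (simp add: scalar_ext_def)
qed

lemma ext_map_no_arrow:
  assumes "a \<in> arcs Q" "y \<in> basis (head Q a)" "\<nexists>x. arrow a x y"
  shows "k_map ext_rep a f y = \<zero>"
proof -
  have none: "{z \<in> basis (tail Q a). f1_map V a z = y} = {}"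
    using assms by (auto simp: arrow_def)
  show ?thesis
    using assms(2) by (simp add: scalar_ext_def none)
qed

lemma ext_map_closed:
  assumes "a \<in> arcs Q" "f \<in> carrier (func_space (basis (tail Q a)))"
  shows "k_map ext_rep a f \<in> carrier (func_space (basis (head Q a)))"
  unfolding func_space_simps
proof (rule PiE_I)
  fix y assume "y \<in> basis (head Q a)"
  then show "k_map ext_rep a f y \<in> carrier K"
    using assms ext_map_arrow[OF _ assms(2)] ext_map_no_arrow[OF assms(1)]
    by (cases "\<exists>x. arrow a x y") (auto simp: func_space_simps dest: arrowD)
qed (simp add: scalar_ext_def)

lemma vector_eqI:
  assumes "f \<in> carrier (func_space S)" "g \<in> carrier (func_space S)"
    and "\<And>x. x \<in> S \<Longrightarrow> f x = g x"
  shows "f = g"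
  using assms by (auto simp: func_space_simps intro: PiE_ext)

lemma ext_map_unit_vector:
  assumes "arrow a x y"
  shows "k_map ext_rep a (unit_vector (tail Q a) x) = unit_vector (head Q a) y"
proof (rule vector_eqI)
  fix z assume z: "z \<in> basis (head Q a)"
  show "k_map ext_rep a (unit_vector (tail Q a) x) z = unit_vector (head Q a) y z"
  proof (cases "\<exists>w. arrow a w z")
    case True
    then obtain w where w: "arrow a w z"
      by blast
    then have "w = x \<longleftrightarrow> z = y"
      using assms arrow_functional arrow_injective by blast
    then show ?thesis
      using ext_map_arrow[OF w basis_vector_closed, of x] z arrowD[OF w] by (simp add: basis_vector_def)
  next
    case False
    then show ?thesis
      using ext_map_no_arrow[OF arrowD(1)[OF assms] z] assms z by (auto simp: basis_vector_def)
  qed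
qed (rule ext_map_closed[OF arrowD(1)[OF assms] basis_vector_closed], rule basis_vector_closed)

lemma ext_map_unit_vector_zero:
  assumes "a \<in> arcs Q" "x \<in> basis (tail Q a)" "\<nexists>y. arrow a x y"
  shows "k_map ext_rep a (unit_vector (tail Q a) x) = \<zero>\<^bsub>func_space (basis (head Q a))\<^esub>"
proof (rule vector_eqI)
  fix z assume z: "z \<in> basis (head Q a)"
  show "k_map ext_rep a (unit_vector (tail Q a) x) z = \<zero>\<^bsub>func_space (basis (head Q a))\<^esub> z"
  proof (cases "\<exists>w. arrow a w z")
    case True
    then obtain w where w: "arrow a w z"
      by blast
    with assms(3) have "w \<noteq> x"
      by blast
    then show ?thesis
      using ext_map_arrow[OF w basis_vector_closed, of x] z arrowD[OF w]
      by (simp add: basis_vector_def func_space_simps)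
  next
    case False
    then show ?thesis
      using ext_map_no_arrow[OF assms(1) z] z by (simp add: func_space_simps)
  qed
qed (rule ext_map_closed[OF assms(1) basis_vector_closed], auto simp: func_space_simps)

lemma scalar_ext_is_rep: "k_rep K Q ext_rep"
  unfolding k_rep_def
proof (intro conjI ballI)
  fix a assume a: "a \<in> arcs Q"
  have at: "k_map ext_rep a f y = (if \<exists>x. arrow a x y then f (SOME x. arrow a x y) else \<zero>)"
    if "f \<in> carrier (func_space (basis (tail Q a)))" "y \<in> basis (head Q a)" for f y
  proof (cases "\<exists>x. arrow a x y")
    case True
    then show ?thesis
      using ext_map_arrow[OF someI_ex[OF True] that(1)] by simp
  next
    case False
    then show ?thesis
      using ext_map_no_arrow[OF a that(2) False] by simp
  qed
  have src: "(SOME x. arrow a x y) \<in> basis (tail Q a)" if "\<exists>x. arrow a x y" for y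
    using arrowD(2)[OF someI_ex[OF that]] .
  show "linear_map K (k_obj ext_rep (tail Q a)) (k_obj ext_rep (head Q a)) (k_map ext_rep a)"
    unfolding ext_obj
  proof (rule linear_mapI)
    fix f g assume fg: "f \<in> carrier (func_space (basis (tail Q a)))"
      "g \<in> carrier (func_space (basis (tail Q a)))"
    then have sum: "f \<oplus>\<^bsub>func_space (basis (tail Q a))\<^esub> g \<in> carrier (func_space (basis (tail Q a)))"
      by (auto simp: func_space_simps)
    show "k_map ext_rep a (f \<oplus>\<^bsub>func_space (basis (tail Q a))\<^esub> g)
        = k_map ext_rep a f \<oplus>\<^bsub>func_space (basis (head Q a))\<^esub> k_map ext_rep a g"
    proof (rule vector_eqI)
      show "k_map ext_rep a f \<oplus>\<^bsub>func_space (basis (head Q a))\<^esub> k_map ext_rep a g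
          \<in> carrier (func_space (basis (head Q a)))"
        using ext_map_closed[OF a fg(1)] ext_map_closed[OF a fg(2)] by (auto simp: func_space_simps)
    qed (use at[OF sum] at[OF fg(1)] at[OF fg(2)] src ext_map_closed[OF a sum]
        in \<open>auto simp: func_space_simps\<close>)
  next
    fix c f assume c: "c \<in> carrier K" and f: "f \<in> carrier (func_space (basis (tail Q a)))"
    then have smult: "c \<odot>\<^bsub>func_space (basis (tail Q a))\<^esub> f \<in> carrier (func_space (basis (tail Q a)))"
      by (auto simp: func_space_simps)
    show "k_map ext_rep a (c \<odot>\<^bsub>func_space (basis (tail Q a))\<^esub> f)
        = c \<odot>\<^bsub>func_space (basis (head Q a))\<^esub> k_map ext_rep a f"
    proof (rule vector_eqI)
      show "c \<odot>\<^bsub>func_space (basis (head Q a))\<^esub> k_map ext_rep a f \<in> carrier (func_space (basis (head Q a)))"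
        using c ext_map_closed[OF a f] by (auto simp: func_space_simps)
    qed (use c at[OF smult] at[OF f] src ext_map_closed[OF a smult]
        in \<open>auto simp: func_space_simps\<close>)
  qed (use func_space_vectorspace ext_map_closed[OF a] in auto)
qed (simp add: func_space_vectorspace)

lemma unit_vector_nonzero: "x \<in> S \<Longrightarrow> basis_vector S x \<noteq> \<zero>\<^bsub>func_space S\<^esub>"
  by (auto simp: basis_vector_def func_space_simps fun_eq_iff)

lemma scalar_ext_nonzero:
  assumes "f1_nonzero Q V"
  shows "k_nonzero Q ext_rep"
proof -
  obtain i x where "i \<in> verts Q" "x \<in> basis i"
    using assms by (auto simp: f1_nonzero_def)
  then show ?thesis
    unfolding k_nonzero_def ext_obj
    using basis_vector_closed[of "basis i" x] unit_vector_nonzero[of x "basis i"] by blast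
qed

section \<open>A rigid representation stays indecomposable over every field\<close>

context
  fixes e :: "'v \<Rightarrow> ('x \<Rightarrow> 'k) \<Rightarrow> ('x \<Rightarrow> 'k)"
  assumes endo: "k_endomorphism K Q ext_rep e"
begin

abbreviation coef :: "'v \<Rightarrow> 'x \<Rightarrow> 'x \<Rightarrow> 'k" where
  "coef i x y \<equiv> e i (unit_vector i x) y"

lemma endo_linear: "i \<in> verts Q \<Longrightarrow> linear_map K (func_space (basis i)) (func_space (basis i)) (e i)"
  using endo by (simp add: k_endomorphism_def)

lemma endo_unit_vector_closed: "i \<in> verts Q \<Longrightarrow> e i (unit_vector i x) \<in> carrier (func_space (basis i))"
  using linear_mapD(3)[OF endo_linear basis_vector_closed] .

lemma coef_closed: "i \<in> verts Q \<Longrightarrow> y \<in> basis i \<Longrightarrow> coef i x y \<in> carrier K"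
  using endo_unit_vector_closed[of i x] by (auto simp: func_space_simps)

lemma endo_commute:
  assumes "a \<in> arcs Q"
  shows "e (head Q a) (k_map ext_rep a (unit_vector (tail Q a) x))
    = k_map ext_rep a (e (tail Q a) (unit_vector (tail Q a) x))"
  using endo assms by (simp add: k_endomorphism_def basis_vector_closed)

lemma coef_along_arrows:
  assumes "arrow a x x'" "arrow a y y'"
  shows "coef (head Q a) x' y' = coef (tail Q a) x y"
  using endo_commute[OF arrowD(1)[OF assms(1)], of x] ext_map_unit_vector[OF assms(1)]
    ext_map_arrow[OF assms(2) endo_unit_vector_closed[OF arrowD(4)[OF assms(1)]], of x]
  by simp

text \<open>
  If an arrow map kills \<open>x\<close>, it kills \<open>e x\<close>, and hence \<open>y\<close>, because the images of distinct basis
  elements do not cancel; dually, if \<open>y'\<close> is not hit by an arrow map, it cannot occur in the image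
  under \<open>e\<close> of an element that is hit. Together with the constancy of the coefficients along arrows,
  this makes the support of \<open>e\<close> a simulation.
\<close>

lemma coef_support_similar:
  assumes "i \<in> verts Q" "x \<in> basis i" "y \<in> basis i" "coef i x y \<noteq> \<zero>"
  shows "similar i x y"
proof (rule similarI[of "\<lambda>i x y. i \<in> verts Q \<and> x \<in> basis i \<and> y \<in> basis i \<and> coef i x y \<noteq> \<zero>"])
  have forward: "\<exists>x'. arrow a x x'"
    if x: "x \<in> basis (tail Q a)" and ne: "coef (tail Q a) x y \<noteq> \<zero>" and y: "arrow a y y'" for a x y y'
  proof (rule ccontr)
    assume "\<nexists>x'. arrow a x x'"
    then have "k_map ext_rep a (unit_vector (tail Q a) x) = \<zero>\<^bsub>func_space (basis (head Q a))\<^esub>"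
      by (rule ext_map_unit_vector_zero[OF arrowD(1)[OF y] x])
    then have "k_map ext_rep a (e (tail Q a) (unit_vector (tail Q a) x)) y' = \<zero>"
      using endo_commute[OF arrowD(1)[OF y], of x] linear_mapD(6)[OF endo_linear[OF arrowD(5)[OF y]]]
        arrowD(3)[OF y] by (simp add: func_space_simps)
    then show False
      using ne ext_map_arrow[OF y endo_unit_vector_closed[OF arrowD(4)[OF y]]] by simp
  qed
  have backward: "\<exists>y. arrow a y y'"
    if y': "y' \<in> basis (head Q a)" and ne: "coef (head Q a) x' y' \<noteq> \<zero>" and x: "arrow a x x'" for a x x' y'
  proof (rule ccontr)
    assume "\<nexists>y. arrow a y y'"
    then have "k_map ext_rep a (e (tail Q a) (unit_vector (tail Q a) x)) y' = \<zero>"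
      by (rule ext_map_no_arrow[OF arrowD(1)[OF x] y'])
    then show False
      using ne endo_commute[OF arrowD(1)[OF x], of x] ext_map_unit_vector[OF x] by simp
  qed
  let ?R = "\<lambda>i x y. i \<in> verts Q \<and> x \<in> basis i \<and> y \<in> basis i \<and> coef i x y \<noteq> \<zero>"
  have step: "?R (tail Q a) x y \<longleftrightarrow> ?R (head Q a) x' y'" if "arrow a x x'" "arrow a y y'" for a x x' y y'
    using coef_along_arrows[OF that] arrowD[OF that(1)] arrowD[OF that(2)] by simp
  show "simulation ?R"
    unfolding simulation_def
  proof (intro conjI[OF _ conjI] allI impI)
    fix a x y y' assume R: "?R (tail Q a) x y" and y: "arrow a y y'"
    then obtain x' where "arrow a x x'"
      using forward[of x a y y'] by blast
    with R step[OF this y] show "\<exists>x'. arrow a x x' \<and> ?R (head Q a) x' y'"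
      by blast
  next
    fix a x x' y' assume R: "?R (head Q a) x' y'" and x: "arrow a x x'"
    then obtain y where "arrow a y y'"
      using backward[of y' a x' x] by blast
    with R step[OF x this] show "\<exists>y. arrow a y y' \<and> ?R (tail Q a) x y"
      by blast
  qed auto
qed (use assms in simp)

text \<open>
  Rigidity makes the matrix of \<open>e\<close> triangular with respect to a partial order, so eigenvalues are
  diagonal entries. Concretely, at a minimal element \<open>w\<close> of the support of an eigenvector \<open>f\<close>, only
  \<open>w\<close> itself contributes to the coordinate of \<open>e f\<close> at \<open>w\<close>.
\<close>

lemma eigenvalue_on_diagonal:
  assumes rigid and i: "i \<in> verts Q" and f: "f \<in> carrier (func_space (basis i))"
    and "f \<noteq> \<zero>\<^bsub>func_space (basis i)\<^esub>" and c: "c \<in> carrier K"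
    and eigen: "e i f = c \<odot>\<^bsub>func_space (basis i)\<^esub> f"
  obtains x where "x \<in> basis i" "coef i x x = c"
proof -
  define S where "S = {x \<in> basis i. f x \<noteq> \<zero>}"
  have "\<exists>x\<in>basis i. f x \<noteq> \<zero>"
  proof (rule ccontr)
    assume "\<not> (\<exists>x\<in>basis i. f x \<noteq> \<zero>)"
    then have "f = \<zero>\<^bsub>func_space (basis i)\<^esub>"
      using f by (intro vector_eqI[of _ "basis i"]) (auto simp: func_space_simps)
    with assms(4) show False
      by simp
  qed
  then have "S \<noteq> {}" "S \<subseteq> basis i"
    by (auto simp: S_def)
  then obtain w where w: "w \<in> S" and minimal: "\<And>y. y \<in> S \<Longrightarrow> similar i y w \<Longrightarrow> y = w"
    using similar_minimal_element[OF \<open>rigid\<close> i] by metis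
  have w_basis: "w \<in> basis i" and f_w: "f w \<in> carrier K" "f w \<noteq> \<zero>"
    using w f by (auto simp: S_def func_space_simps)
  have "c \<otimes> f w = e i f w"
    using eigen w_basis by (simp add: func_space_simps)
  also have "\<dots> = (\<Oplus>x\<in>basis i. f x \<otimes> coef i x w)"
    by (rule linear_map_expansion[OF endo_linear[OF i] finite_basis[OF i] f w_basis])
  also have "\<dots> = (\<Oplus>x\<in>basis i. if w = x then f x \<otimes> coef i x w else \<zero>)"
  proof (rule finsum_cong')
    show "f x \<otimes> coef i x w = (if w = x then f x \<otimes> coef i x w else \<zero>)" if x: "x \<in> basis i" for x
    proof (cases "f x = \<zero> \<or> coef i x w = \<zero>")
      case True
      then show ?thesis
        using vector_closed[OF f x] coef_closed[OF i w_basis] by auto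
    next
      case False
      then have "x = w"
        using minimal[of x] coef_support_similar[OF i x w_basis] x by (auto simp: S_def)
      then show ?thesis
        by simp
    qed
  qed (use vector_closed[OF f] coef_closed[OF i w_basis] in auto)
  also have "\<dots> = f w \<otimes> coef i w w"
    using vector_closed[OF f] coef_closed[OF i w_basis]
    by (intro finsum_singleton[OF w_basis finite_basis[OF i]]) auto
  also have "\<dots> = coef i w w \<otimes> f w"
    using f_w coef_closed[OF i w_basis] by (simp add: m_comm)
  finally have "coef i w w = c"
    using c f_w coef_closed[OF i w_basis] m_rcancel by metis
  with w_basis show ?thesis
    by (rule that)
qed

lemma diagonal_constant:
  assumes "f1_indecomposable Q V"
    and "i \<in> verts Q" "x \<in> basis i" "j \<in> verts Q" "y \<in> basis j"
  shows "coef i x x = coef j y y"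
proof -
  have "{x \<in> basis i. coef i x x = coef j y y} = basis i"
  proof (rule indecomposable_imp_connected[OF assms(1), of "\<lambda>i. {x \<in> basis i. coef i x x = coef j y y}" j])
    show "x \<in> {x \<in> basis (tail Q a). coef (tail Q a) x x = coef j y y} \<longleftrightarrow>
        z \<in> {x \<in> basis (head Q a). coef (head Q a) x x = coef j y y}" if "arrow a x z" for a x z
      using coef_along_arrows[OF that that] arrowD[OF that] by simp
  qed (use assms in auto)
  with assms(3) show ?thesis
    by blast
qed

end

text \<open>
  A decomposition provides an endomorphism with the eigenvalues \<open>0\<close> and \<open>1\<close>. Both would have to be
  diagonal entries, but the diagonal is constant.
\<close>

theorem rigid_imp_scalar_ext_indecomposable:
  assumes "f1_indecomposable Q V" rigid
  shows "k_indecomposable K Q ext_rep"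
proof (rule ccontr)
  have "k_nonzero Q ext_rep"
    using assms(1) by (intro scalar_ext_nonzero) (simp add: f1_indecomposable_def)
  moreover assume "\<not> k_indecomposable K Q ext_rep"
  ultimately obtain e i f j g where endo: "k_endomorphism K Q ext_rep e"
    and f: "i \<in> verts Q" "f \<in> carrier (func_space (basis i))"
      "f \<noteq> \<zero>\<^bsub>func_space (basis i)\<^esub>" "e i f = f"
    and g: "j \<in> verts Q" "g \<in> carrier (func_space (basis j))"
      "g \<noteq> \<zero>\<^bsub>func_space (basis j)\<^esub>" "e j g = \<zero>\<^bsub>func_space (basis j)\<^esub>"
    using decomposable_imp_splitting_endomorphism[OF scalar_ext_is_rep wf_digraph_axioms]
    unfolding ext_obj by metis
  have "f = \<one> \<odot>\<^bsub>func_space (basis i)\<^esub> f"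
    using f(2) vector_closed[OF f(2)]
    by (intro vector_eqI[of _ "basis i"]) (auto simp: func_space_simps)
  then obtain x where x: "x \<in> basis i" "e i (unit_vector i x) x = \<one>"
    using eigenvalue_on_diagonal[OF endo \<open>rigid\<close> f(1,2,3) one_closed] f(4) by metis
  have "\<zero>\<^bsub>func_space (basis j)\<^esub> = \<zero> \<odot>\<^bsub>func_space (basis j)\<^esub> g"
    using g(2) vector_closed[OF g(2)]
    by (intro vector_eqI[of _ "basis j"]) (auto simp: func_space_simps)
  then obtain y where y: "y \<in> basis j" "e j (unit_vector j y) y = \<zero>"
    using eigenvalue_on_diagonal[OF endo \<open>rigid\<close> g(1,2,3) zero_closed] g(4) by metis
  show False
    using diagonal_constant[OF endo assms(1) f(1) x(1) g(1) y(1)] x(2) y(2) by simp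
qed

section \<open>Averaging over bisimilarity classes\<close>

abbreviation bisim_class :: "'v \<Rightarrow> 'x \<Rightarrow> 'x set" where
  "bisim_class i x \<equiv> {y. bisimilar i x y}"

definition average :: "'v \<Rightarrow> ('x \<Rightarrow> 'k) \<Rightarrow> ('x \<Rightarrow> 'k)" where
  "average i f = (\<lambda>x\<in>basis i.
     inv ([card (bisim_class i x)] \<cdot> \<one>) \<otimes> (\<Oplus>y\<in>bisim_class i x. f y))"

lemma bisim_class_subset: "bisim_class i x \<subseteq> basis i"
  by (auto dest: bisimilarD)

lemma finite_bisim_class: "i \<in> verts Q \<Longrightarrow> finite (bisim_class i x)"
  using finite_subset[OF bisim_class_subset finite_basis] .

lemma bisim_class_eq: "bisimilar i x y \<Longrightarrow> bisim_class i x = bisim_class i y"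
  using bisimilar_trans bisimilar_sym by blast

text \<open>
  This is why averaging commutes with the arrow maps: an arrow that is defined at one member of a
  bisimilarity class is defined on the whole class and maps it onto a whole class.
\<close>

lemma arrow_bij_betw_bisim_class:
  assumes "arrow a x y"
  shows "bij_betw (f1_map V a) (bisim_class (tail Q a) x) (bisim_class (head Q a) y)"
proof -
  have arr: "arrow a z (f1_map V a z)" "bisimilar (head Q a) y (f1_map V a z)"
    if z: "bisimilar (tail Q a) x z" for z
  proof -
    obtain z' where "arrow a z z'" "bisimilar (head Q a) y z'"
      using bisimilar_forward[OF z assms] by blast
    then show "arrow a z (f1_map V a z)" "bisimilar (head Q a) y (f1_map V a z)"
      by (simp_all add: arrow_def)
  qed
  have "w \<in> f1_map V a ` bisim_class (tail Q a) x" if w: "bisimilar (head Q a) y w" for w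
  proof -
    obtain z where "arrow a z w" "bisimilar (tail Q a) x z"
      using bisimilar_backward[OF w assms] by blast
    then show ?thesis
      by (auto simp: arrow_def)
  qed
  with arr show ?thesis
    unfolding bij_betw_def inj_on_def by (auto intro: arrow_injective) (metis arrow_injective)
qed

context
  assumes char_zero: "\<And>n :: nat. n > 0 \<Longrightarrow> [n] \<cdot> \<one> \<noteq> \<zero>"
begin

lemma class_size_inverse:
  assumes "i \<in> verts Q" "x \<in> basis i"
  shows "inv ([card (bisim_class i x)] \<cdot> \<one>) \<in> carrier K - {\<zero>}"
    "inv ([card (bisim_class i x)] \<cdot> \<one>) \<otimes> ([card (bisim_class i x)] \<cdot> \<one>) = \<one>"
proof -
  have "card (bisim_class i x) > 0"
    using bisimilar_refl[OF assms] finite_bisim_class[OF assms(1)] by (auto simp: card_gt_0_iff)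
  then have "[card (bisim_class i x)] \<cdot> \<one> \<in> Units K"
    using char_zero add.nat_pow_closed[OF one_closed] by (simp add: field_Units)
  then show "inv ([card (bisim_class i x)] \<cdot> \<one>) \<in> carrier K - {\<zero>}"
    "inv ([card (bisim_class i x)] \<cdot> \<one>) \<otimes> ([card (bisim_class i x)] \<cdot> \<one>) = \<one>"
    using Units_inv_Units field_Units by auto
qed

lemma class_values_closed:
  "f \<in> carrier (func_space (basis i)) \<Longrightarrow> f \<in> bisim_class i x \<rightarrow> carrier K"
  using bisim_class_subset by (auto simp: func_space_simps)

lemma average_closed:
  assumes "i \<in> verts Q" "f \<in> carrier (func_space (basis i))"
  shows "average i f \<in> carrier (func_space (basis i))"
  using class_size_inverse[OF assms(1)] class_values_closed[OF assms(2)]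
  by (auto simp: func_space_simps average_def intro!: m_closed finsum_closed)

lemma average_linear:
  assumes i: "i \<in> verts Q"
  shows "linear_map K (func_space (basis i)) (func_space (basis i)) (average i)"
proof (rule linear_mapI)
  fix f g assume fg: "f \<in> carrier (func_space (basis i))" "g \<in> carrier (func_space (basis i))"
  show "average i (f \<oplus>\<^bsub>func_space (basis i)\<^esub> g) = average i f \<oplus>\<^bsub>func_space (basis i)\<^esub> average i g"
    unfolding func_space_simps average_def
  proof (intro restrict_ext)
    fix x assume x: "x \<in> basis i"
    have "(\<Oplus>y\<in>bisim_class i x. (\<lambda>x\<in>basis i. f x \<oplus> g x) y) = (\<Oplus>y\<in>bisim_class i x. f y \<oplus> g y)"
      using fg[THEN class_values_closed, of x] bisim_class_subset[of i x] by (intro finsum_cong') auto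
    also have "\<dots> = (\<Oplus>y\<in>bisim_class i x. f y) \<oplus> (\<Oplus>y\<in>bisim_class i x. g y)"
      using fg[THEN class_values_closed, of x] by (rule finsum_addf)
    finally show "inv ([card (bisim_class i x)] \<cdot> \<one>) \<otimes> (\<Oplus>y\<in>bisim_class i x. (\<lambda>x\<in>basis i. f x \<oplus> g x) y)
      = (\<lambda>x\<in>basis i. inv ([card (bisim_class i x)] \<cdot> \<one>) \<otimes> (\<Oplus>y\<in>bisim_class i x. f y)) x
        \<oplus> (\<lambda>x\<in>basis i. inv ([card (bisim_class i x)] \<cdot> \<one>) \<otimes> (\<Oplus>y\<in>bisim_class i x. g y)) x"
      using class_size_inverse(1)[OF i x] fg[THEN class_values_closed, of x] x by (simp add: r_distr)
  qed
next
  fix c f assume c: "c \<in> carrier K" and f: "f \<in> carrier (func_space (basis i))"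
  show "average i (c \<odot>\<^bsub>func_space (basis i)\<^esub> f) = c \<odot>\<^bsub>func_space (basis i)\<^esub> average i f"
    unfolding func_space_simps average_def
  proof (intro restrict_ext)
    fix x assume x: "x \<in> basis i"
    have "(\<Oplus>y\<in>bisim_class i x. (\<lambda>x\<in>basis i. c \<otimes> f x) y) = (\<Oplus>y\<in>bisim_class i x. c \<otimes> f y)"
      using c class_values_closed[OF f, of x] bisim_class_subset[of i x] by (intro finsum_cong') auto
    also have "\<dots> = c \<otimes> (\<Oplus>y\<in>bisim_class i x. f y)"
      using finsum_rdistr[OF finite_bisim_class[OF i] c class_values_closed[OF f]] by simp
    finally show "inv ([card (bisim_class i x)] \<cdot> \<one>) \<otimes> (\<Oplus>y\<in>bisim_class i x. (\<lambda>x\<in>basis i. c \<otimes> f x) y)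
      = c \<otimes> (\<lambda>x\<in>basis i. inv ([card (bisim_class i x)] \<cdot> \<one>) \<otimes> (\<Oplus>y\<in>bisim_class i x. f y)) x"
      using class_size_inverse(1)[OF i x] class_values_closed[OF f, of x] x c by (simp add: m_lcomm)
  qed
qed (use i average_closed func_space_vectorspace in auto)

lemma average_idempotent:
  assumes i: "i \<in> verts Q" and f: "f \<in> carrier (func_space (basis i))"
  shows "average i (average i f) = average i f"
proof (rule vector_eqI)
  fix x assume x: "x \<in> basis i"
  let ?n = "card (bisim_class i x)" and ?c = "average i f x"
  have c: "?c \<in> carrier K"
    using average_closed[OF i f] x by (auto simp: func_space_simps)
  have "(\<Oplus>y\<in>bisim_class i x. average i f y) = (\<Oplus>y\<in>bisim_class i x. ?c)"
  proof (rule finsum_cong')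
    show "average i f y = ?c" if "y \<in> bisim_class i x" for y
      using that bisim_class_eq[of i x y] x bisimilarD(3)[of i x y] by (simp add: average_def)
  qed (use c in auto)
  also have "\<dots> = [?n] \<cdot> ?c"
    using c by (rule add.finprod_const)
  also have "\<dots> = ([?n] \<cdot> \<one>) \<otimes> ?c"
    using c add_pow_ldistr[OF one_closed c] by simp
  finally show "average i (average i f) x = ?c"
    using x c class_size_inverse[OF i x]
    by (simp add: average_def[of i "average i f"] m_assoc[symmetric] add.nat_pow_closed[OF one_closed])
qed (use average_closed i f in auto)

lemma average_commute:
  assumes a: "a \<in> arcs Q" and f: "f \<in> carrier (func_space (basis (tail Q a)))"
  shows "average (head Q a) (k_map ext_rep a f) = k_map ext_rep a (average (tail Q a) f)"
proof (rule vector_eqI)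
  note closed = average_closed[OF tail_in_verts[OF a] f]
  fix y assume y: "y \<in> basis (head Q a)"
  show "average (head Q a) (k_map ext_rep a f) y = k_map ext_rep a (average (tail Q a) f) y"
  proof (cases "\<exists>x. arrow a x y")
    case True
    then obtain x where x: "arrow a x y"
      by blast
    note bij = arrow_bij_betw_bisim_class[OF x]
    have arr: "arrow a z (f1_map V a z)" if "z \<in> bisim_class (tail Q a) x" for z
      using bisimilar_forward[OF _ x] that by (fastforce simp: arrow_def)
    have "(\<Oplus>w\<in>bisim_class (head Q a) y. k_map ext_rep a f w)
        = (\<Oplus>w\<in>f1_map V a ` bisim_class (tail Q a) x. k_map ext_rep a f w)"
      using bij by (simp add: bij_betw_def)
    also have "\<dots> = (\<Oplus>z\<in>bisim_class (tail Q a) x. k_map ext_rep a f (f1_map V a z))"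
      using bij class_values_closed[OF ext_map_closed[OF a f], of y]
      by (intro finsum_reindex) (auto simp: bij_betw_def)
    also have "\<dots> = (\<Oplus>z\<in>bisim_class (tail Q a) x. f z)"
      using class_values_closed[OF f] ext_map_arrow[OF arr f] by (intro finsum_cong') auto
    finally show ?thesis
      using ext_map_arrow[OF x closed] y arrowD[OF x] bij_betw_same_card[OF bij]
      by (simp add: average_def)
  next
    case False
    have "\<nexists>z. arrow a z w" if "w \<in> bisim_class (head Q a) y" for w
      using that False bisimilar_backward bisimilar_sym by (metis mem_Collect_eq)
    then have "(\<Oplus>w\<in>bisim_class (head Q a) y. k_map ext_rep a f w)
        = (\<Oplus>w\<in>bisim_class (head Q a) y. \<zero>)"
      using ext_map_no_arrow[OF a] bisimilarD(3) by (intro finsum_cong') auto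
    then show ?thesis
      using ext_map_no_arrow[OF a y False] y class_size_inverse(1)[OF head_in_verts[OF a] y]
      by (simp add: average_def)
  qed
qed (use average_closed ext_map_closed a f in auto)

text \<open>
  If \<open>x\<close> and \<open>y\<close> are distinct and bisimilar, the average of \<open>x\<close> has a nonzero coordinate at \<open>y\<close>, so
  averaging is an idempotent endomorphism different from \<open>0\<close> and from the identity.
\<close>

theorem scalar_ext_indecomposable_imp_rigid:
  assumes "k_indecomposable K Q ext_rep"
  shows rigid
proof (rule ccontr)
  assume "\<not> rigid"
  then obtain i x y where bisim: "bisimilar i x y" and "x \<noteq> y"
    by (auto simp: rigid_def)
  note i = bisimilarD(1)[OF bisim] and x = bisimilarD(2)[OF bisim] and y = bisimilarD(3)[OF bisim]
  have "(\<Oplus>z\<in>bisim_class i y. unit_vector i x z) = (\<Oplus>z\<in>bisim_class i y. if x = z then \<one> else \<zero>)"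
    using bisim_class_subset[of i y] by (intro finsum_cong') (auto simp: basis_vector_def)
  also have "\<dots> = \<one>"
    using bisim by (intro finsum_singleton finite_bisim_class[OF i]) (auto simp: bisimilar_sym[of i y])
  finally have at_y: "average i (unit_vector i x) y \<noteq> \<zero>"
    using y class_size_inverse(1)[OF i y] by (simp add: average_def)
  have "k_endomorphism K Q ext_rep average"
    using average_linear average_commute by (simp add: k_endomorphism_def)
  moreover have "average i (unit_vector i x) \<noteq> \<zero>\<^bsub>func_space (basis i)\<^esub>"
    using at_y y by (auto simp: func_space_simps)
  moreover have "average i (unit_vector i x) \<noteq> unit_vector i x"
    using at_y y \<open>x \<noteq> y\<close> by (auto simp: basis_vector_def)
  ultimately have "\<not> k_indecomposable K Q ext_rep"
    using average_idempotent i
    by (intro idempotent_endomorphism_imp_decomposable[OF wf_digraph_axioms scalar_ext_is_rep,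
          of average i "unit_vector i x"])
      (simp_all add: basis_vector_closed)
  with assms show False
    by simp
qed

end

end

section \<open>The complex numbers as a subfield of a sum type\<close>

text \<open>
  The field that gives access to the complex numbers inside the quantifier of absolute
  indecomposability.
\<close>

definition complex_copy :: "('k + complex) ring" where
  "complex_copy = image_ring Inr class_ring"

lemma add_pow_0: "[(0 :: nat)] \<cdot>\<^bsub>R\<^esub> x = \<zero>\<^bsub>R\<^esub>"
  by (simp add: add_pow_def)

lemma add_pow_Suc: "[Suc n] \<cdot>\<^bsub>R\<^esub> x = [n] \<cdot>\<^bsub>R\<^esub> x \<oplus>\<^bsub>R\<^esub> x"
  by (simp add: add_pow_def nat_pow_def)

lemma class_ring_add_pow:
  "[(n :: nat)] \<cdot>\<^bsub>class_ring\<^esub> (\<one>\<^bsub>class_ring\<^esub> :: 'a :: field_char_0) = of_nat n"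
  by (induction n) (simp_all add: add_pow_0 add_pow_Suc)

lemma complex_copy_field: "field (complex_copy :: ('k + complex) ring)"
  unfolding complex_copy_def by (intro field.inj_imp_image_ring_is_field class_field) simp

lemma complex_copy_zero: "\<zero>\<^bsub>complex_copy\<^esub> = (Inr 0 :: 'k + complex)"
  by (simp add: complex_copy_def image_ring_zero)

lemma complex_copy_one: "\<one>\<^bsub>complex_copy\<^esub> = (Inr 1 :: 'k + complex)"
  by (simp add: complex_copy_def image_ring_one)

lemma complex_copy_add_pow:
  "[(n :: nat)] \<cdot>\<^bsub>complex_copy\<^esub> \<one>\<^bsub>complex_copy\<^esub> = (Inr (of_nat n) :: 'k + complex)"
proof -
  have "Inr (x + y) = (Inr x :: 'k + complex) \<oplus>\<^bsub>complex_copy\<^esub> Inr y" for x y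
    using ring_iso_memE(3)[OF inj_imp_image_ring_iso[of "Inr :: complex \<Rightarrow> 'k + complex" class_ring]]
    by (simp add: complex_copy_def)
  note add = this[symmetric]
  show ?thesis
    by (induction n)
      (simp_all add: add_pow_0 add_pow_Suc add complex_copy_one complex_copy_zero ac_simps)
qed

theorem theorem1p1:
  fixes Q :: "('v, 'e) pre_digraph" and V :: "('v, 'e, 'x) f1_rep"
  assumes "fin_digraph Q"
    and "f1_rep Q V"
    and "f1_indecomposable Q V"
  shows "(absolutely_indecomposable TYPE('k + complex) Q V
           \<longleftrightarrow> k_indecomposable (class_ring :: complex ring) Q (scalar_ext class_ring Q V))
       \<and> (k_indecomposable (class_ring :: complex ring) Q (scalar_ext class_ring Q V)
           \<longleftrightarrow> (\<exists>!C. covering_component Q V V C))"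
proof -
  interpret f1_quiver_rep Q V
    using assms(1,2) by (rule f1_quiver_rep.intro)
  have sufficient: "k_indecomposable K Q (scalar_ext K Q V)" if rigid "field K" for K :: "'u ring"
  proof -
    interpret f1_scalar_extension Q V K
      using f1_quiver_rep_axioms \<open>field K\<close> by (rule f1_scalar_extension.intro)
    show ?thesis
      using assms(3) \<open>rigid\<close> by (rule rigid_imp_scalar_ext_indecomposable)
  qed
  have necessary_C: rigid
    if "k_indecomposable (class_ring :: complex ring) Q (scalar_ext class_ring Q V)"
  proof -
    interpret C: f1_scalar_extension Q V "class_ring :: complex ring"
      using f1_quiver_rep_axioms class_field by (rule f1_scalar_extension.intro)
    show ?thesis
      using that by (rule C.scalar_ext_indecomposable_imp_rigid[rotated])
        (simp only: class_ring_add_pow, simp)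
  qed
  have necessary_copy: rigid
    if "k_indecomposable (complex_copy :: ('k + complex) ring) Q (scalar_ext complex_copy Q V)"
  proof -
    interpret C: f1_scalar_extension Q V "complex_copy :: ('k + complex) ring"
      using f1_quiver_rep_axioms complex_copy_field by (rule f1_scalar_extension.intro)
    show ?thesis
      using that by (rule C.scalar_ext_indecomposable_imp_rigid[rotated])
        (simp only: complex_copy_add_pow complex_copy_zero, simp)
  qed
  have "k_indecomposable (class_ring :: complex ring) Q (scalar_ext class_ring Q V) \<longleftrightarrow> rigid"
    using sufficient[OF _ class_field] necessary_C by blast
  moreover have "absolutely_indecomposable TYPE('k + complex) Q V \<longleftrightarrow> rigid"
    using assms(3) sufficient necessary_copy complex_copy_field
    unfolding absolutely_indecomposable_def by blast
  moreover have "rigid \<longleftrightarrow> (\<exists>!C. covering_component Q V V C)"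
    using assms(3) by (rule rigid_iff_unique_covering_component)
  ultimately show ?thesis
    by blast
qed

end
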